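(* For $k\in\mathbb{N}$, the vectors $f_0^k[1]=\frac{1}{k!}\langle\xi,\mathfrak{f}_1\rangle^k[1]$ are highest weight vectors of weight $(k)=(k,0,\dots,0)$, i.e. the action of the maximal torus $\mathbb{T}$ of $\mathrm{Spin}(m)$ on them is given by $$H(s)\,f_0^k[1]=\exp(k\,i\,t_1)\,f_0^k[1]\qquad\text{for all } s=\exp\Big(\tfrac12\big(t_1R_2R_1+\dots+t_nR_{2n}R_{2n-1}\big)\Big)\in\mathbb{T}.$$
   Context: Clifford algebra: $\mathbb{C}_{2m,0}$ is the complex Clifford algebra generated by $\mathbf{e}_j^{\pm}$, $j=1,\dots,m$ ($m\ge2$), with $\{\mathbf{e}_j^+,\mathbf{e}_k^+\}=\{\mathbf{e}_j^-,\mathbf{e}_k^-\}=0$, $\{\mathbf{e}_j^+,\mathbf{e}_k^-\}=\delta_{jk}$ ($\{a,b\}=ab+ba$); $e_j=\mathbf{e}_j^++\mathbf{e}_j^-$. Discrete functions are functions $f:\mathbb{Z}^m\to\mathbb{C}_{2m,0}$. With $\Delta_j^+f(x)=f(x+e_j)-f(x)$, $\Delta_j^-f(x)=f(x)-f(x-e_j)$ (in the argument $e_j$ denotes the $j$-th unit lattice vector), put $\partial_j=\mathbf{e}_j^+\Delta_j^++\mathbf{e}_j^-\Delta_j^-$. Basic polynomials: for $\alpha\in\mathbb{N}^m$, $\xi^\alpha[1]=\xi_1^{\alpha_1}\cdots\xi_m^{\alpha_m}[1]$ is the discrete function determined by $\xi^0[1]=1$, $\partial_j\,\xi^\alpha[1]=(-1)^{\alpha_1+\dots+\alpha_{j-1}}\alpha_j\,\xi^{\alpha-\epsilon_j}[1]$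 ($\epsilon_j$ the $j$-th unit multi-index) and $\xi^\alpha[1](0)=0$ for $\alpha\ne0$. Discrete polynomials are the finite sums $f=\sum_\alpha\xi^\alpha[1]\,c_\alpha$, $c_\alpha\in\mathbb{C}_{2m,0}$ (with unique coefficients). The right $\mathbb{C}_{2m,0}$-linear operators $\xi_j,R_j$ on discrete polynomials are given by $\xi_j(\xi^\alpha[1])=(-1)^{\alpha_1+\dots+\alpha_{j-1}}\xi^{\alpha+\epsilon_j}[1]$ and $R_j(\xi^\alpha[1])=(-1)^{|\alpha|-\alpha_j}\xi^\alpha[1]\,e_j$. They satisfy $\{\xi_j,\xi_k\}=0$ ($j\neq k$), $\{R_j,R_k\}=2\delta_{jk}$, $R_j[1]=e_j$, $\{R_j,\xi_k\}=2R_j\xi_j\delta_{jk}$. Put $\xi=\sum_j\xi_j$ and $\langle X,Y\rangle=\frac12(XY+YX)$ for operators $X,Y$. The operator $\mathfrak{f}_1=\frac12(R_1-i\,R_2)$, and for an operator $X$, $X[1]$ denotes its action on the constant function $1$. Spin group: $\mathbb{R}^1_m=\{\sum_j\omega_jR_j:\omega_j\in\mathbb{R}\}$, $S^{m-1}=\{\underline\omega\in\mathbb{R}^1_m:\underline\omega^2=1\}$; $\mathrm{Spin}(m)$ is the group of products of an even number of elements of $S^{m-1}$. The conjugation satisfies $\overline{R_j}=-R_j$, $\overline{ab}=\bar b\,\bar a$. With $n=\lfloor m/2\rfloor$, $\mathbb{T}=\{\exp(\frac12(t_1R_2R_1+\dots+t_nR_{2n}R_{2n-1})):t_j\in\mathbb{R}\}$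 is the maximal torus of $\mathrm{Spin}(m)$. Actions: for $s\in\mathrm{Spin}(m)$ let $\eta=\bar s\,\xi\,s$, $\eta_j=\langle\eta,R_j\rangle R_j$. For $f=\sum_\alpha\xi^\alpha[1]c_\alpha$, $f(\bar s\,\xi\,s)=\sum_\alpha\eta_1^{\alpha_1}\cdots\eta_m^{\alpha_m}[1]\,c_\alpha$; $H^0(s)f=f(\bar s\,\xi\,s)$ and $H^1(s)f=s\,f(\bar s\,\xi\,s)\,\bar s$ (left factor $s$ acting as an operator, right factor meaning right multiplication by the constant $\bar s[1]$). In the claim $H(s)$ stands for either $H^0(s)$ or $H^1(s)$, which agree on $f_0^k[1]$. *)

theory Defs
  imports "HOL-Analysis.Analysis"
begin

section \<open>The complex Clifford algebra on \<open>2m\<close> generators\<close>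

text \<open>
  The index set \<open>{1, \<dots>, m}\<close> is a finite linearly ordered type \<open>'m\<close>, so \<open>m = CARD('m)\<close>.

  The algebra is realised with an orthonormal set of generators \<open>g (j, b)\<close>, one for each
  \<open>(j, b) :: 'm \<times> bool\<close>, which pairwise anticommute and square to \<open>1\<close>. It has the basis of
  the products \<open>g\<^sub>A\<close>, \<open>A \<subseteq> 'm \<times> bool\<close>, of the generators in \<open>A\<close> taken in
  (lexicographically) increasing order; an element is its family of coordinates.
  The Witt generators are \<open>e\<^sub>j\<^sup>+ = (g (j, False) + i g (j, True)) / 2\<close> and
  \<open>e\<^sub>j\<^sup>- = (g (j, False) - i g (j, True)) / 2\<close>.
\<close>

typedef 'm clifford = "UNIV :: (('m \<times> bool) set \<Rightarrow> complex) set"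
  morphisms coord Clifford
  by simp

setup_lifting type_definition_clifford

definition gen_less :: "'m::linorder \<times> bool \<Rightarrow> 'm \<times> bool \<Rightarrow> bool" where
  "gen_less a b \<longleftrightarrow> fst a < fst b \<or> (fst a = fst b \<and> snd a < snd b)"

text \<open>
  \<open>g\<^sub>A g\<^sub>B = reorder_sign A B \<cdot> g\<^sub>C\<close>, where \<open>C\<close> is the symmetric difference of \<open>A\<close> and \<open>B\<close>.
\<close>

definition reorder_sign :: "('m::linorder \<times> bool) set \<Rightarrow> ('m \<times> bool) set \<Rightarrow> complex" where
  "reorder_sign A B = (\<Prod>a\<in>A. \<Prod>b\<in>B. if gen_less b a then - 1 else 1)"

lemma sum_singleton_if:
  fixes f :: "'a \<Rightarrow> 'b::comm_monoid_add"
  assumes "finite A" "a \<in> A" "\<And>x. x \<in> A \<Longrightarrow> x \<noteq> a \<Longrightarrow> f x = 0"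
  shows "sum f A = f a"
  using assms by (simp add: sum.remove[of A a])

lemma prod_sign_sym_diff:
  fixes f :: "'a \<Rightarrow> complex"
  assumes "finite A" "finite B" "\<And>x. f x * f x = 1"
  shows "prod f (sym_diff A B) = prod f A * prod f B"
proof -
  have A: "prod f A = prod f (A - B) * prod f (A \<inter> B)"
    using prod.Int_Diff[OF assms(1), of f B] by (simp add: mult.commute)
  have B: "prod f B = prod f (B - A) * prod f (A \<inter> B)"
    using prod.Int_Diff[OF assms(2), of f A] by (simp add: mult.commute Int_commute)
  have sq: "prod f (A \<inter> B) * prod f (A \<inter> B) = 1"
    by (simp add: prod.distrib[symmetric] assms(3))
  have "prod f (sym_diff A B) = prod f (A - B) * prod f (B - A)"
    using assms by (intro prod.union_disjoint) auto
  also have "\<dots> = prod f (A - B) * prod f (B - A) * (prod f (A \<inter> B) * prod f (A \<inter> B))"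
    by (simp add: sq)
  finally show ?thesis by (simp add: A B mult_ac)
qed

lemma reorder_sign_sym_diff_left:
  fixes A B C :: "('m::{finite,linorder} \<times> bool) set"
  shows "reorder_sign (sym_diff A B) C = reorder_sign A C * reorder_sign B C"
  unfolding reorder_sign_def
  by (rule prod_sign_sym_diff) (auto simp: prod.distrib[symmetric] intro!: prod.neutral)

lemma reorder_sign_sym_diff_right:
  fixes A B C :: "('m::{finite,linorder} \<times> bool) set"
  shows "reorder_sign A (sym_diff B C) = reorder_sign A B * reorder_sign A C"
  unfolding reorder_sign_def prod.distrib[symmetric]
  by (intro prod.cong refl prod_sign_sym_diff) auto

instantiation clifford :: ("{finite,linorder}") ring_1
begin

lift_definition zero_clifford :: "'a clifford" is "\<lambda>_. 0" .

lift_definition one_clifford :: "'a clifford" is "\<lambda>A. if A = {} then 1 else 0" .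

lift_definition plus_clifford :: "'a clifford \<Rightarrow> 'a clifford \<Rightarrow> 'a clifford"
  is "\<lambda>a b A. a A + b A" .

lift_definition minus_clifford :: "'a clifford \<Rightarrow> 'a clifford \<Rightarrow> 'a clifford"
  is "\<lambda>a b A. a A - b A" .

lift_definition uminus_clifford :: "'a clifford \<Rightarrow> 'a clifford"
  is "\<lambda>a A. - a A" .

text \<open>In the sum, \<open>B = sym_diff A C\<close> is the set with \<open>sym_diff A B = C\<close>.\<close>

lift_definition times_clifford :: "'a clifford \<Rightarrow> 'a clifford \<Rightarrow> 'a clifford"
  is "\<lambda>a b C. \<Sum>A\<in>UNIV. reorder_sign A (sym_diff A C) * a A * b (sym_diff A C)" .

instance
proof
  fix a b c :: "'a clifford"
  show "a * b * c = a * (b * c)"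
  proof (transfer, rule ext)
    fix a b c :: "('a \<times> bool) set \<Rightarrow> complex" and D
    let ?s = "reorder_sign :: ('a \<times> bool) set \<Rightarrow> _"
    have "(\<Sum>E\<in>UNIV. ?s E (sym_diff E D) * (\<Sum>A\<in>UNIV. ?s A (sym_diff A E) * a A * b (sym_diff A E)) * c (sym_diff E D))
       = (\<Sum>E\<in>UNIV. \<Sum>A\<in>UNIV. ?s E (sym_diff E D) * ?s A (sym_diff A E) * a A * b (sym_diff A E) * c (sym_diff E D))"
      by (simp add: sum_distrib_left sum_distrib_right mult_ac)
    also have "\<dots> = (\<Sum>A\<in>UNIV. \<Sum>E\<in>UNIV. ?s E (sym_diff E D) * ?s A (sym_diff A E) * a A * b (sym_diff A E) * c (sym_diff E D))"
      by (rule sum.swap)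
    also have "\<dots> = (\<Sum>A\<in>UNIV. \<Sum>B\<in>UNIV. ?s A (sym_diff A D) * a A * (?s B (sym_diff B (sym_diff A D)) * b B * c (sym_diff B (sym_diff A D))))"
    proof (rule sum.cong[OF refl])
      fix A :: "('a \<times> bool) set"
      have bij: "bij_betw (sym_diff A) UNIV UNIV"
        by (rule bij_betwI[of _ _ _ "sym_diff A"]) auto
      have AB: "sym_diff A (sym_diff A B) = B" for B by auto
      have "(\<Sum>E\<in>UNIV. ?s E (sym_diff E D) * ?s A (sym_diff A E) * a A * b (sym_diff A E) * c (sym_diff E D))
        = (\<Sum>B\<in>UNIV. ?s (sym_diff A B) (sym_diff (sym_diff A B) D) * ?s A B * a A * b B * c (sym_diff (sym_diff A B) D))"
        by (subst sum.reindex_bij_betw[OF bij, symmetric]) (simp only: AB)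
      also have "\<dots> = (\<Sum>B\<in>UNIV. ?s A (sym_diff A D) * a A * (?s B (sym_diff B (sym_diff A D)) * b B * c (sym_diff B (sym_diff A D))))"
      proof (rule sum.cong[OF refl])
        fix B :: "('a \<times> bool) set"
        let ?F = "sym_diff (sym_diff A B) D"
        have F: "sym_diff B (sym_diff A D) = ?F" by auto
        have D: "sym_diff A D = sym_diff B ?F" by auto
        have "?s (sym_diff A B) ?F * ?s A B = ?s A (sym_diff A D) * ?s B ?F"
          unfolding D by (simp only: reorder_sign_sym_diff_left reorder_sign_sym_diff_right mult_ac)
        then show "?s (sym_diff A B) ?F * ?s A B * a A * b B * c ?F
          = ?s A (sym_diff A D) * a A * (?s B (sym_diff B (sym_diff A D)) * b B * c (sym_diff B (sym_diff A D)))"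
          unfolding F by (simp only: mult_ac)
      qed
      finally show "(\<Sum>E\<in>UNIV. ?s E (sym_diff E D) * ?s A (sym_diff A E) * a A * b (sym_diff A E) * c (sym_diff E D))
        = (\<Sum>B\<in>UNIV. ?s A (sym_diff A D) * a A * (?s B (sym_diff B (sym_diff A D)) * b B * c (sym_diff B (sym_diff A D))))" .
    qed
    finally show "(\<Sum>E\<in>UNIV. ?s E (sym_diff E D) * (\<Sum>A\<in>UNIV. ?s A (sym_diff A E) * a A * b (sym_diff A E)) * c (sym_diff E D))
      = (\<Sum>A\<in>UNIV. ?s A (sym_diff A D) * a A * (\<Sum>B\<in>UNIV. ?s B (sym_diff B (sym_diff A D)) * b B * c (sym_diff B (sym_diff A D))))"
      by (simp add: sum_distrib_left)
  qed
  show "1 * a = a"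
  proof (transfer, rule ext)
    fix a :: "('a \<times> bool) set \<Rightarrow> complex" and C
    show "(\<Sum>A\<in>UNIV. reorder_sign A (sym_diff A C) * (if A = {} then 1 else 0) * a (sym_diff A C)) = a C"
      by (subst sum_singleton_if[where a = "{}"]) (auto simp: reorder_sign_def)
  qed
  show "a * 1 = a"
  proof (transfer, rule ext)
    fix a :: "('a \<times> bool) set \<Rightarrow> complex" and C
    show "(\<Sum>A\<in>UNIV. reorder_sign A (sym_diff A C) * a A * (if sym_diff A C = {} then 1 else 0)) = a C"
      by (subst sum_singleton_if[where a = C]) (auto simp: reorder_sign_def)
  qed
  show "(a + b) * c = a * c + b * c" "a * (b + c) = a * b + a * c"
    by (transfer, rule ext, simp add: sum.distrib[symmetric] algebra_simps)+
  show "(0::'a clifford) \<noteq> 1"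
    by transfer (auto simp: fun_eq_iff)
qed (transfer; simp add: algebra_simps fun_eq_iff)+

end

instantiation clifford :: ("{finite,linorder}") real_algebra_1
begin

lift_definition scaleR_clifford :: "real \<Rightarrow> 'a clifford \<Rightarrow> 'a clifford"
  is "\<lambda>r a A. r *\<^sub>R a A" .

instance
  by standard
    (transfer; simp add: fun_eq_iff scaleR_add_right scaleR_add_left scaleR_sum_right)+

end

lift_definition blade :: "('m \<times> bool) set \<Rightarrow> 'm clifford"
  is "\<lambda>A B. if B = A then 1 else 0" .

lift_definition cconst :: "complex \<Rightarrow> 'm clifford"
  is "\<lambda>z A. if A = {} then z else 0" .

definition e_plus :: "'m::{finite,linorder} \<Rightarrow> 'm clifford" where
  "e_plus j = cconst (1/2) * (blade {(j, False)} + cconst \<i> * blade {(j, True)})"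

definition e_minus :: "'m::{finite,linorder} \<Rightarrow> 'm clifford" where
  "e_minus j = cconst (1/2) * (blade {(j, False)} - cconst \<i> * blade {(j, True)})"

definition e_unit :: "'m::{finite,linorder} \<Rightarrow> 'm clifford" where
  "e_unit j = e_plus j + e_minus j"

lemma blade_mult:
  fixes A B :: "('m::{finite,linorder} \<times> bool) set"
  shows "blade A * blade B = cconst (reorder_sign A B) * blade (sym_diff A B)"
proof (transfer, rule ext)
  fix A B C :: "('m \<times> bool) set"
  have eq: "sym_diff A C = B \<longleftrightarrow> C = sym_diff A B" by auto
  have canc: "sym_diff A (sym_diff A B) = B" by auto
  have "(\<Sum>D\<in>UNIV. reorder_sign D (sym_diff D C) * (if D = A then 1 else 0) * (if sym_diff D C = B then 1 else 0))
      = (if C = sym_diff A B then reorder_sign A B else 0)"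
    by (subst sum_singleton_if[where a = A]) (simp_all only: eq finite UNIV_I, auto simp only: canc if_True if_False mult_1_right mult_zero_right mult_zero_left split: if_splits)
  also have "\<dots> = (\<Sum>D\<in>UNIV. reorder_sign D (sym_diff D C) * (if D = {} then reorder_sign A B else 0) * (if sym_diff D C = sym_diff A B then 1 else 0))"
    by (subst sum_singleton_if[where a = "{}"]) (auto simp: reorder_sign_def)
  finally show "(\<Sum>D\<in>UNIV. reorder_sign D (sym_diff D C) * (if D = A then 1 else 0) * (if sym_diff D C = B then 1 else 0))
    = (\<Sum>D\<in>UNIV. reorder_sign D (sym_diff D C) * (if D = {} then reorder_sign A B else 0) * (if sym_diff D C = sym_diff A B then 1 else 0))" .
qed

lemma coord_cconst_mult: "coord (cconst z * a) A = z * coord a A"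
  for a :: "'m::{finite,linorder} clifford"
proof (transfer)
  fix z and a :: "('m \<times> bool) set \<Rightarrow> complex" and A
  show "(\<Sum>B\<in>UNIV. reorder_sign B (sym_diff B A) * (if B = {} then z else 0) * a (sym_diff B A)) = z * a A"
    by (subst sum_singleton_if[where a = "{}"]) (auto simp: reorder_sign_def)
qed

lemma coord_mult_cconst: "coord (a * cconst z) A = z * coord a A"
  for a :: "'m::{finite,linorder} clifford"
proof (transfer)
  fix z and a :: "('m \<times> bool) set \<Rightarrow> complex" and A
  show "(\<Sum>B\<in>UNIV. reorder_sign B (sym_diff B A) * a B * (if sym_diff B A = {} then z else 0)) = z * a A"
    by (subst sum_singleton_if[where a = A]) (auto simp: reorder_sign_def)
qed

lemma cconst_central: "a * cconst z = cconst z * a"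
  for a :: "'m::{finite,linorder} clifford"
  by (simp add: coord_inject[symmetric] fun_eq_iff coord_cconst_mult coord_mult_cconst)

lemma cconst_mult: "cconst z * cconst w = (cconst (z * w) :: 'm::{finite,linorder} clifford)"
  by (simp add: coord_inject[symmetric] fun_eq_iff coord_cconst_mult cconst.rep_eq)

lemma cconst_add: "cconst z + cconst w = (cconst (z + w) :: 'm::{finite,linorder} clifford)"
  by (transfer, auto)

lemma cconst_0 [simp]: "cconst 0 = (0 :: 'm::{finite,linorder} clifford)"
  by (transfer, auto)

lemma cconst_1 [simp]: "cconst 1 = (1 :: 'm::{finite,linorder} clifford)"
  by (transfer, auto)

lemma cconst_minus: "cconst (- z) = (- cconst z :: 'm::{finite,linorder} clifford)"
  by (transfer, auto)

lemma blade_empty [simp]: "blade {} = (1 :: 'm::{finite,linorder} clifford)"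
  by (transfer, auto)

lemma blade_square [simp]:
  fixes a :: "'m::{finite,linorder} \<times> bool"
  shows "blade {a} * blade {a} = 1"
  by (simp add: blade_mult reorder_sign_def gen_less_def)

lemma blade_anticommute:
  fixes a b :: "'m::{finite,linorder} \<times> bool"
  assumes "a \<noteq> b"
  shows "blade {a} * blade {b} = - (blade {b} * blade {a})"
proof -
  have "reorder_sign {a} {b} = - reorder_sign {b} {a}"
    using assms by (cases a; cases b) (auto simp: reorder_sign_def gen_less_def)
  moreover have "sym_diff {a} {b} = sym_diff {b} {a}" by auto
  ultimately show ?thesis by (simp only: blade_mult cconst_minus minus_mult_left)
qed

lemma gen_combination_anticommutator:
  fixes a b c d :: "'m::{finite,linorder} clifford"
  assumes "a * c + c * a = p" "b * c + c * b = q" "a * d + d * a = r" "b * d + d * b = s"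
  shows "(cconst z * (a + cconst u * b)) * (cconst z * (c + cconst v * d))
    + (cconst z * (c + cconst v * d)) * (cconst z * (a + cconst u * b))
    = cconst (z * z) * (p + cconst u * q + cconst v * r + cconst (u * v) * s)"
proof -
  have pull: "x * (cconst w * y) = cconst w * (x * y)" for x y :: "'m clifford" and w
    by (simp only: mult.assoc[symmetric] cconst_central)
  have merge: "cconst w * (cconst w' * y) = cconst (w * w') * y" for y :: "'m clifford" and w w'
    by (simp only: mult.assoc[symmetric] cconst_mult)
  show ?thesis
    unfolding assms[symmetric]
    by (simp only: distrib_left distrib_right mult.assoc pull[of a] pull[of b] pull[of c]
        pull[of d] merge) (simp only: mult_ac add_ac)
qed

lemma e_relations:
  fixes j k :: "'m::{finite,linorder}"
  shows "e_plus j * e_plus k + e_plus k * e_plus j = 0"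
    and "e_minus j * e_minus k + e_minus k * e_minus j = 0"
    and "e_plus j * e_minus k + e_minus k * e_plus j = (if j = k then 1 else 0)"
proof -
  have ac: "blade {(j, b)} * blade {(k, c)} + blade {(k, c)} * blade {(j, b)}
      = (if j = k \<and> b = c then 1 + 1 else 0 :: 'm clifford)" for b c
    using blade_anticommute[of "(j, b)" "(k, c)"] by auto
  have m: "e_minus l = cconst (1/2) * (blade {(l, False)} + cconst (- \<i>) * blade {(l, True)})" for l :: 'm
    by (simp add: e_minus_def cconst_minus)
  have 2: "(2 :: 'm clifford) = cconst 2"
    using cconst_add[of 1 1, where 'm = 'm] by simp
  note c = gen_combination_anticommutator[OF ac ac ac ac]
  show "e_plus j * e_plus k + e_plus k * e_plus j = 0"
    unfolding e_plus_def c by (simp add: cconst_minus cconst_mult)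
  show "e_minus j * e_minus k + e_minus k * e_minus j = 0"
    unfolding m c by (simp add: cconst_minus cconst_mult)
  show "e_plus j * e_minus k + e_minus k * e_plus j = (if j = k then 1 else 0)"
    unfolding e_plus_def m c by (simp add: 2 cconst_mult cconst_add)
qed


lemma blade_insert:
  fixes A :: "('m::{finite,linorder} \<times> bool) set"
  assumes "\<And>b. b \<in> A \<Longrightarrow> gen_less a b"
  shows "blade (insert a A) = blade {a} * blade A"
proof -
  have "sym_diff {a} A = insert a A"
    using assms by (force simp: gen_less_def)
  moreover have "reorder_sign {a} A = 1"
    using assms by (force simp: reorder_sign_def gen_less_def intro!: prod.neutral)
  ultimately show ?thesis by (simp only: blade_mult cconst_1 mult_1_left)
qed

lemma blade_eq_e:
  fixes j :: "'m::{finite,linorder}"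
  shows "blade {(j, False)} = e_plus j + e_minus j"
    and "blade {(j, True)} = cconst (- \<i>) * (e_plus j - e_minus j)"
  by (rule coord_inject[THEN iffD1];
      simp add: e_plus_def e_minus_def fun_eq_iff coord_cconst_mult plus_clifford.rep_eq
        minus_clifford.rep_eq field_simps)+


lifting_update clifford.lifting
lifting_forget clifford.lifting


section \<open>Discrete functions and the basic polynomials\<close>

type_synonym 'm dfun = "(int, 'm) vec \<Rightarrow> 'm clifford"

definition dDiff_plus :: "'m::{finite,linorder} \<Rightarrow> 'm dfun \<Rightarrow> 'm dfun" where
  "dDiff_plus j f x = f (x + axis j 1) - f x"

definition dDiff_minus :: "'m::{finite,linorder} \<Rightarrow> 'm dfun \<Rightarrow> 'm dfun" where
  "dDiff_minus j f x = f x - f (x - axis j 1)"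

definition dpartial :: "'m::{finite,linorder} \<Rightarrow> 'm dfun \<Rightarrow> 'm dfun" where
  "dpartial j f x = e_plus j * dDiff_plus j f x + e_minus j * dDiff_minus j f x"

type_synonym 'm mindex = "'m \<Rightarrow> nat"

text \<open>
  \<open>basic_fun \<alpha>\<close> is \<open>\<xi>\<^sup>\<alpha>[1]\<close>. In the first condition the factor \<open>\<alpha> j\<close> makes the truncated
  subtraction harmless.
\<close>

definition basic_fun :: "'m::{finite,linorder} mindex \<Rightarrow> 'm dfun" where
  "basic_fun = (THE X.
      (\<forall>\<alpha> j x. dpartial j (X \<alpha>) x
         = (-1) ^ (\<Sum>i\<in>{..<j}. \<alpha> i) * of_nat (\<alpha> j) * X (\<alpha>(j := \<alpha> j - 1)) x) \<and>
      (\<forall>x. X (\<lambda>_. 0) x = 1) \<and>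
      (\<forall>\<alpha>. \<alpha> \<noteq> (\<lambda>_. 0) \<longrightarrow> X \<alpha> 0 = 0))"

typedef (overloaded) 'm dpoly =
  "{f :: 'm::{finite,linorder} dfun. \<exists>c. finite {\<alpha>. c \<alpha> \<noteq> 0} \<and>
      f = (\<lambda>x. \<Sum>\<alpha> | c \<alpha> \<noteq> 0. basic_fun \<alpha> x * c \<alpha>)}"
  morphisms poly_fun Dpoly
  by (rule exI[of _ "\<lambda>_. 0"]) (auto intro!: exI[of _ "\<lambda>_. 0"])

setup_lifting type_definition_dpoly

lemma dpoly_memI:
  fixes f :: "'m::{finite,linorder} dfun"
  assumes "finite S" "\<And>x. f x = (\<Sum>\<alpha>\<in>S. basic_fun \<alpha> x * c \<alpha>)"
  shows "\<exists>c. finite {\<alpha>. c \<alpha> \<noteq> 0} \<and> f = (\<lambda>x. \<Sum>\<alpha> | c \<alpha> \<noteq> 0. basic_fun \<alpha> x * c \<alpha>)"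
proof -
  define d where "d \<alpha> = (if \<alpha> \<in> S then c \<alpha> else 0)" for \<alpha>
  have sub: "{\<alpha>. d \<alpha> \<noteq> 0} \<subseteq> S" by (auto simp: d_def)
  have "f x = (\<Sum>\<alpha> | d \<alpha> \<noteq> 0. basic_fun \<alpha> x * d \<alpha>)" for x
    unfolding assms(2)
    by (rule sum.mono_neutral_cong_right[OF assms(1) sub]) (auto simp: d_def)
  then show ?thesis
    using finite_subset[OF sub assms(1)] by (intro exI[of _ d]) auto
qed

instantiation dpoly :: ("{finite,linorder}") real_vector
begin

lift_definition zero_dpoly :: "'a dpoly" is "\<lambda>_. 0"
  by (auto intro!: exI[of _ "\<lambda>_. 0"])

lift_definition plus_dpoly :: "'a dpoly \<Rightarrow> 'a dpoly \<Rightarrow> 'a dpoly" is "\<lambda>f g x. f x + g x"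
proof (elim exE conjE)
  fix f g :: "'a dfun" and c d
  assume fin: "finite {\<alpha>. c \<alpha> \<noteq> 0}" "finite {\<alpha>. d \<alpha> \<noteq> 0}"
    and f: "f = (\<lambda>x. \<Sum>\<alpha> | c \<alpha> \<noteq> 0. basic_fun \<alpha> x * c \<alpha>)"
    and g: "g = (\<lambda>x. \<Sum>\<alpha> | d \<alpha> \<noteq> 0. basic_fun \<alpha> x * d \<alpha>)"
  let ?S = "{\<alpha>. c \<alpha> \<noteq> 0} \<union> {\<alpha>. d \<alpha> \<noteq> 0}"
  have "f x = (\<Sum>\<alpha>\<in>?S. basic_fun \<alpha> x * c \<alpha>)" "g x = (\<Sum>\<alpha>\<in>?S. basic_fun \<alpha> x * d \<alpha>)" for x
    unfolding f g using fin by (auto intro!: sum.mono_neutral_left)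
  then show "\<exists>c. finite {\<alpha>. c \<alpha> \<noteq> 0} \<and> (\<lambda>x. f x + g x) = (\<lambda>x. \<Sum>\<alpha> | c \<alpha> \<noteq> 0. basic_fun \<alpha> x * c \<alpha>)"
    using fin by (intro dpoly_memI[of ?S _ "\<lambda>\<alpha>. c \<alpha> + d \<alpha>"]) (auto simp: sum.distrib distrib_left)
qed

lift_definition uminus_dpoly :: "'a dpoly \<Rightarrow> 'a dpoly" is "\<lambda>f x. - f x"
proof (elim exE conjE)
  fix f :: "'a dfun" and c
  assume fin: "finite {\<alpha>. c \<alpha> \<noteq> 0}"
    and f: "f = (\<lambda>x. \<Sum>\<alpha> | c \<alpha> \<noteq> 0. basic_fun \<alpha> x * c \<alpha>)"
  then show "\<exists>c. finite {\<alpha>. c \<alpha> \<noteq> 0} \<and> (\<lambda>x. - f x) = (\<lambda>x. \<Sum>\<alpha> | c \<alpha> \<noteq> 0. basic_fun \<alpha> x * c \<alpha>)"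
    by (intro dpoly_memI[of "{\<alpha>. c \<alpha> \<noteq> 0}" _ "\<lambda>\<alpha>. - c \<alpha>"]) (auto simp: sum_negf)
qed

definition minus_dpoly :: "'a dpoly \<Rightarrow> 'a dpoly \<Rightarrow> 'a dpoly" where
  "minus_dpoly f g = f + - g"

lift_definition scaleR_dpoly :: "real \<Rightarrow> 'a dpoly \<Rightarrow> 'a dpoly" is "\<lambda>r f x. r *\<^sub>R f x"
proof (elim exE conjE)
  fix f :: "'a dfun" and c and r :: real
  assume fin: "finite {\<alpha>. c \<alpha> \<noteq> 0}"
    and f: "f = (\<lambda>x. \<Sum>\<alpha> | c \<alpha> \<noteq> 0. basic_fun \<alpha> x * c \<alpha>)"
  then show "\<exists>c. finite {\<alpha>. c \<alpha> \<noteq> 0} \<and> (\<lambda>x. r *\<^sub>R f x) = (\<lambda>x. \<Sum>\<alpha> | c \<alpha> \<noteq> 0. basic_fun \<alpha> x * c \<alpha>)"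
    by (intro dpoly_memI[of "{\<alpha>. c \<alpha> \<noteq> 0}" _ "\<lambda>\<alpha>. r *\<^sub>R c \<alpha>"]) (auto simp: scaleR_sum_right)
qed

instance
  by standard
    (simp_all add: poly_fun_inject[symmetric] fun_eq_iff minus_dpoly_def zero_dpoly.rep_eq
      plus_dpoly.rep_eq uminus_dpoly.rep_eq scaleR_dpoly.rep_eq scaleR_add_right scaleR_add_left add_ac)

end

lift_definition basic_poly :: "'m::{finite,linorder} mindex \<Rightarrow> 'm dpoly" is basic_fun
  subgoal for \<alpha>
    by (rule dpoly_memI[of "{\<alpha>}" _ "\<lambda>_. 1"]) auto
  done

definition one_poly :: "'m::{finite,linorder} dpoly" where
  "one_poly = basic_poly (\<lambda>_. 0)"

text \<open>Pointwise right multiplication by a constant.\<close>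

lift_definition rmult :: "'m::{finite,linorder} dpoly \<Rightarrow> 'm clifford \<Rightarrow> 'm dpoly"
  is "\<lambda>f a x. f x * a"
proof (elim exE conjE)
  fix f :: "'m dfun" and c a
  assume fin: "finite {\<alpha>. c \<alpha> \<noteq> 0}"
    and f: "f = (\<lambda>x. \<Sum>\<alpha> | c \<alpha> \<noteq> 0. basic_fun \<alpha> x * c \<alpha>)"
  then show "\<exists>c. finite {\<alpha>. c \<alpha> \<noteq> 0} \<and> (\<lambda>x. f x * a) = (\<lambda>x. \<Sum>\<alpha> | c \<alpha> \<noteq> 0. basic_fun \<alpha> x * c \<alpha>)"
    by (intro dpoly_memI[of "{\<alpha>. c \<alpha> \<noteq> 0}" _ "\<lambda>\<alpha>. c \<alpha> * a"]) (auto simp: sum_distrib_right mult.assoc)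
qed

text \<open>Multiplication by a complex number; the scalars are central, so the side is immaterial.\<close>

definition cscale :: "complex \<Rightarrow> 'm::{finite,linorder} dpoly \<Rightarrow> 'm dpoly" where
  "cscale z f = rmult f (cconst z)"

definition dcoeff :: "'m::{finite,linorder} dpoly \<Rightarrow> 'm mindex \<Rightarrow> 'm clifford" where
  "dcoeff f = (THE c. finite {\<alpha>. c \<alpha> \<noteq> 0} \<and> f = (\<Sum>\<alpha> | c \<alpha> \<noteq> 0. rmult (basic_poly \<alpha>) (c \<alpha>)))"

text \<open>The right linear operator with \<open>\<xi>\<^sup>\<alpha>[1] \<mapsto> B \<alpha>\<close>.\<close>

definition rlinear_ext :: "('m::{finite,linorder} mindex \<Rightarrow> 'm dpoly) \<Rightarrow> 'm dpoly \<Rightarrow> 'm dpoly" where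
  "rlinear_ext B f = (\<Sum>\<alpha> | dcoeff f \<alpha> \<noteq> 0. rmult (B \<alpha>) (dcoeff f \<alpha>))"


section \<open>Operators on discrete polynomials\<close>

type_synonym 'm dop = "'m dpoly \<Rightarrow> 'm dpoly"

definition xi_op :: "'m::{finite,linorder} \<Rightarrow> 'm dop" where
  "xi_op j = rlinear_ext (\<lambda>\<alpha>. (-1) ^ (\<Sum>i\<in>{..<j}. \<alpha> i) *\<^sub>R basic_poly (\<alpha>(j := \<alpha> j + 1)))"

definition R_op :: "'m::{finite,linorder} \<Rightarrow> 'm dop" where
  "R_op j = rlinear_ext (\<lambda>\<alpha>. (-1) ^ ((\<Sum>i\<in>UNIV. \<alpha> i) - \<alpha> j) *\<^sub>R rmult (basic_poly \<alpha>) (e_unit j))"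

definition xi :: "'m::{finite,linorder} dop" where
  "xi f = (\<Sum>j\<in>UNIV. xi_op j f)"

definition op_angle :: "'m::{finite,linorder} dop \<Rightarrow> 'm dop \<Rightarrow> 'm dop" where
  "op_angle X Y f = (1/2) *\<^sub>R (X (Y f) + Y (X f))"

text \<open>\<open>idx k\<close> is the \<open>k\<close>-th index, for \<open>1 \<le> k \<le> m\<close>.\<close>

definition idx :: "nat \<Rightarrow> 'm::{finite,linorder}" where
  "idx k = sorted_list_of_set UNIV ! (k - 1)"

definition f1_op :: "'m::{finite,linorder} dop" where
  "f1_op f = (1/2) *\<^sub>R (R_op (idx 1) f - cscale \<i> (R_op (idx 2) f))"

definition f0_pow :: "nat \<Rightarrow> 'm::{finite,linorder} dpoly" where
  "f0_pow k = (1 / fact k) *\<^sub>R ((op_angle xi f1_op ^^ k) one_poly)"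

text \<open>
  The exponential series of an operator, applied to a polynomial, converges coordinatewise at
  every lattice point.
\<close>

definition op_exp :: "'m::{finite,linorder} dop \<Rightarrow> 'm dop" where
  "op_exp X f = (THE g. \<forall>x A.
      (\<lambda>n. coord (poly_fun ((1 / fact n) *\<^sub>R ((X ^^ n) f)) x) A) sums coord (poly_fun g x) A)"

text \<open>
  The conjugation on the real algebra generated by the operators \<open>R\<^sub>j\<close>, first as a relation: it
  is the real linear antiautomorphism with \<open>R\<^sub>j \<mapsto> - R\<^sub>j\<close>.
\<close>

inductive op_conj_rel :: "'m::{finite,linorder} dop \<Rightarrow> 'm dop \<Rightarrow> bool" where
  scalar: "op_conj_rel (\<lambda>f. r *\<^sub>R f) (\<lambda>f. r *\<^sub>R f)"
| gen: "op_conj_rel (R_op j) (\<lambda>f. - R_op j f)"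
| add: "op_conj_rel a a' \<Longrightarrow> op_conj_rel b b' \<Longrightarrow> op_conj_rel (\<lambda>f. a f + b f) (\<lambda>f. a' f + b' f)"
| mult: "op_conj_rel a a' \<Longrightarrow> op_conj_rel b b' \<Longrightarrow> op_conj_rel (a \<circ> b) (b' \<circ> a')"

definition op_conj :: "'m::{finite,linorder} dop \<Rightarrow> 'm dop" where
  "op_conj a = (THE a'. op_conj_rel a a')"


section \<open>The spin group and its actions\<close>

definition unit_sphere :: "'m::{finite,linorder} dop set" where
  "unit_sphere = {w. (\<exists>\<omega> :: 'm \<Rightarrow> real. w = (\<lambda>f. \<Sum>j\<in>UNIV. \<omega> j *\<^sub>R R_op j f)) \<and> w \<circ> w = id}"

definition spin_group :: "'m::{finite,linorder} dop set" where
  "spin_group = {foldr (\<circ>) ws id | ws. set ws \<subseteq> unit_sphere \<and> even (length ws)}"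

definition torus_element :: "(nat \<Rightarrow> real) \<Rightarrow> 'm::{finite,linorder} dop" where
  "torus_element t = op_exp (\<lambda>f. (1/2) *\<^sub>R
      (\<Sum>j=1..CARD('m) div 2. t j *\<^sub>R R_op (idx (2 * j)) (R_op (idx (2 * j - 1)) f)))"

text \<open>The maximal torus of \<open>spin_group\<close>.\<close>

definition max_torus :: "'m::{finite,linorder} dop set" where
  "max_torus = range torus_element"

definition eta :: "'m::{finite,linorder} dop \<Rightarrow> 'm dop" where
  "eta s = op_conj s \<circ> xi \<circ> s"

definition eta_op :: "'m::{finite,linorder} dop \<Rightarrow> 'm \<Rightarrow> 'm dop" where
  "eta_op s j = op_angle (eta s) (R_op j) \<circ> R_op j"

text \<open>\<open>\<eta>\<^sub>1\<^bsup>\<alpha>\<^sub>1\<^esup> \<cdots> \<eta>\<^sub>m\<^bsup>\<alpha>\<^sub>m\<^esup>\<close>, with the factors composed in increasing order of the index.\<close>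

definition eta_monomial :: "'m::{finite,linorder} dop \<Rightarrow> 'm mindex \<Rightarrow> 'm dop" where
  "eta_monomial s \<alpha> = foldr (\<lambda>j X. (eta_op s j ^^ \<alpha> j) \<circ> X) (sorted_list_of_set UNIV) id"

definition H0 :: "'m::{finite,linorder} dop \<Rightarrow> 'm dop" where
  "H0 s = rlinear_ext (\<lambda>\<alpha>. eta_monomial s \<alpha> one_poly)"

text \<open>
  The polynomial \<open>op_conj s one_poly\<close> is a constant function; its value is read off at the
  origin.
\<close>

definition H1 :: "'m::{finite,linorder} dop \<Rightarrow> 'm dop" where
  "H1 s f = rmult (s (H0 s f)) (poly_fun (op_conj s one_poly) 0)"

end

theory Submission
  imports Defs
begin

text \<open>
  Write \<open>\<chi>\<^sub>j = R\<^sub>j \<xi>\<^sub>j\<close>. These operators commute with each other and with all \<open>R\<^sub>k\<close>, and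
  \<open>\<langle>\<xi>, f\<^sub>1\<rangle> = (\<chi>\<^sub>1 - i \<chi>\<^sub>2) / 2\<close>. For \<open>s\<close> in the torus, conjugation by \<open>s\<close> rotates the \<open>R\<^sub>k\<close> in the planes
  \<open>(2p - 1, 2p)\<close>; since \<open>\<xi> = \<Sum>\<^sub>k R\<^sub>k \<chi>\<^sub>k\<close>, the substitution \<open>\<xi> \<mapsto> \<eta>\<close> acts on the \<open>\<chi>\<^sub>k\<close> by the transposed rotation,
  so \<open>H\<^sup>0(s)\<close> turns \<open>\<chi>\<^sub>1 - i \<chi>\<^sub>2\<close> into \<open>exp(i t\<^sub>1) (\<chi>\<^sub>1 - i \<chi>\<^sub>2)\<close> and fixes \<open>1\<close>. The additional factors in
  \<open>H\<^sup>1(s)\<close> cancel because \<open>s\<close> commutes with the \<open>\<chi>\<^sub>k\<close>.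
\<close>

section \<open>The Witt generators\<close>

text \<open>\<open>basic_fun\<close>, \<open>dcoeff\<close>, \<open>op_exp\<close> and
  \<open>op_conj\<close> are definite descriptions, so existence and uniqueness have to be settled
  for each of them before a weight can be computed. The delicate one is \<open>op_conj\<close>:
  conjugation is prescribed on words in the \<open>R_op j\<close>, and different words can be the
  same operator, as \<open>R_op j \<circ> R_op j\<close> and the identity are. It is therefore
  compared with an antiautomorphism of the coefficient algebra. \<open>\<chi>\<^sub>j\<close>
  commutes with \<open>R\<^sub>k\<close> because \<open>R\<^sub>k\<close> passes both factors
  \<open>R\<^sub>j\<close> and \<open>\<xi>\<^sub>j\<close> with the same sign. This replaces
  anticommuting variables by commuting ones. Only \<open>t 1\<close> enters the weight, since every
  later plane is disjoint from the indices 1 and 2. A weight vector must also be nonzero, which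
  takes a separate argument in an algebra with zero divisors.\<close>

lemma clifford_double_eq_0: "a + a = 0 \<Longrightarrow> a = 0" for a :: "'m::{finite,linorder} clifford"
  by (metis scaleR_2 scaleR_eq_0_iff zero_neq_numeral)

lemma e_plus_square [simp]: "e_plus j * e_plus j = 0"
  and e_minus_square [simp]: "e_minus j * e_minus j = 0"
  by (rule clifford_double_eq_0, rule e_relations)+

lemma e_anticommute:
  assumes "j \<noteq> k"
  shows "e_plus j * e_plus k = - (e_plus k * e_plus j)"
    and "e_plus j * e_minus k = - (e_minus k * e_plus j)"
    and "e_minus j * e_plus k = - (e_plus k * e_minus j)"
    and "e_minus j * e_minus k = - (e_minus k * e_minus j)"
  using e_relations(1,2,3)[of j k] e_relations(3)[of k j] assms
  by (simp_all add: eq_neg_iff_add_eq_0 add.commute)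

lemma e_plus_minus: "e_plus j * e_minus j = 1 - e_minus j * e_plus j"
  using e_relations(3)[of j j] by (simp add: eq_diff_eq)

lemma e_unit_square [simp]: "e_unit j * e_unit j = 1"
  by (simp add: e_unit_def distrib_left distrib_right e_plus_minus)

lemma e_unit_mult_cancel [simp]: "e_unit j * (e_unit j * a) = a"
  by (simp add: mult.assoc[symmetric])

lemma e_unit_anticommute: "j \<noteq> k \<Longrightarrow> e_unit j * e_unit k = - (e_unit k * e_unit j)"
  by (simp add: e_unit_def distrib_left distrib_right e_anticommute[of j k])

lemma e_plus_cancel_minus:
  "e_plus j * (e_minus j * e_plus j) = e_plus j" "e_minus j * (e_plus j * e_minus j) = e_minus j"
proof -
  show "e_plus j * (e_minus j * e_plus j) = e_plus j"
    by (simp only: mult.assoc[symmetric] e_plus_minus) (simp add: algebra_simps)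
  show "e_minus j * (e_plus j * e_minus j) = e_minus j"
    by (simp only: e_plus_minus) (simp add: algebra_simps mult.assoc[symmetric])
qed


section \<open>The basic polynomials\<close>

definition antidiff :: "(int \<Rightarrow> 'a::ab_group_add) \<Rightarrow> int \<Rightarrow> 'a" where
  "antidiff h x = (if 0 \<le> x then \<Sum>i\<in>{0..<x}. h i else - (\<Sum>i\<in>{x..<0}. h i))"

lemma antidiff_0 [simp]: "antidiff h 0 = 0"
  by (simp add: antidiff_def)

lemma antidiff_step: "antidiff h (x + 1) = antidiff h x + h x"
proof (cases "0 \<le> x")
  case True
  then have "{0..<x + 1} = insert x {0..<x}" by auto
  with True show ?thesis by (simp add: antidiff_def add.commute)
next
  case False
  then have "{x..<0} = insert x {x + 1..<0}" by auto
  with False show ?thesis by (auto simp: antidiff_def)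
qed

text \<open>The coefficient of \<open>\<xi>\<^sub>j\<^sup>k[1]\<close> on the range of
  \<open>e\<^sub>j\<^sup>- e\<^sub>j\<^sup>+\<close>. Its forward difference is a multiple of the
  other coefficient one degree lower, because one \<open>e_unit j\<close> is split off the power and
  exchanges the two idempotents. That other coefficient is the reflection
  \<open>(-1) ^ k * line_coeff k (- x)\<close>, whence the sign and the argument
  \<open>- x\<close>.\<close>

primrec line_coeff :: "nat \<Rightarrow> int \<Rightarrow> int" where
  "line_coeff 0 = (\<lambda>_. 1)"
| "line_coeff (Suc k) = antidiff (\<lambda>x. int (Suc k) * (-1) ^ k * line_coeff k (- x))"

text \<open>
  \<open>\<xi>\<^sub>j\<^sup>k[1]\<close>. Multiplying \<open>\<partial>\<^sub>j f = k \<xi>\<^sub>j\<^bsup>k-1\<^esup>[1]\<close> by \<open>e\<^sub>j\<close> on the left decouples it into a forward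
  difference equation on the range of the idempotent \<open>e\<^sub>j\<^sup>- e\<^sub>j\<^sup>+\<close> and a backward one on the
  range of \<open>e\<^sub>j\<^sup>+ e\<^sub>j\<^sup>-\<close>; the reflection \<open>x \<mapsto> - x\<close> exchanges the two.
\<close>

definition line_poly :: "'m::{finite,linorder} \<Rightarrow> nat \<Rightarrow> int \<Rightarrow> 'm clifford" where
  "line_poly j k x = (e_minus j * e_plus j * of_int (line_coeff k x)
     + e_plus j * e_minus j * of_int ((-1) ^ k * line_coeff k (- x))) * e_unit j ^ k"

lemma line_poly_0 [simp]: "line_poly j 0 x = 1"
  using e_relations(3)[of j j] by (simp add: line_poly_def add.commute)

lemma line_poly_at_0: "0 < k \<Longrightarrow> line_poly j k 0 = 0"
  by (cases k) (simp_all add: line_poly_def)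

text \<open>The Witt generators square to 0, so \<open>e_plus j\<close> sees only the first
  coefficient of \<open>line_poly\<close> and \<open>e_minus j\<close> only the second. Splitting
  one \<open>e_unit j\<close> off the power then restores the idempotents, as
  \<open>e_plus j * e_unit j = e_plus j * e_minus j\<close>.\<close>

lemma line_poly_diff:
  "e_plus j * (line_poly j k (x + 1) - line_poly j k x)
     + e_minus j * (line_poly j k x - line_poly j k (x - 1)) = of_nat k * line_poly j (k - 1) x"
proof (cases k)
  case 0
  then show ?thesis by simp
next
  case (Suc l)
  let ?p = "e_plus j" and ?q = "e_minus j" and ?e = "e_unit j"
  let ?a = "line_coeff l x" and ?b = "(-1) ^ l * line_coeff l (- x)"
  have a: "line_coeff k (x + 1) = line_coeff k x + int k * ?b"
    by (simp add: Suc antidiff_step)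
  \<comment> \<open>The backward difference of the reflected coefficient at \<open>x\<close> comes
    from a forward difference of \<open>line_coeff k\<close> at \<open>- x\<close>.\<close>
  have b: "line_coeff k (- (x - 1)) = line_coeff k (- x) + int k * ((-1) ^ l * ?a)"
    using antidiff_step[of "\<lambda>x. int (Suc l) * (-1) ^ l * line_coeff l (- x)" "- x"]
    by (simp add: Suc)
  have c: "(-1) ^ k * line_coeff k (- x) - (-1) ^ k * line_coeff k (- (x - 1)) = int k * ?a"
    unfolding b by (simp add: Suc algebra_simps flip: power_mult_distrib)
  have comm: "of_int z * a = a * of_int z" for z and a :: "'a clifford"
    by (rule mult_of_int_commute)
  have L: "?p * line_poly j k y = ?p * of_int (line_coeff k y) * ?e ^ k"
    "?q * line_poly j k y = ?q * of_int ((-1) ^ k * line_coeff k (- y)) * ?e ^ k" for y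
    unfolding line_poly_def
    by (simp_all only: distrib_left mult.assoc[symmetric] e_plus_square e_minus_square)
      (simp_all add: mult.assoc e_plus_cancel_minus)
  have "?p * (line_poly j k (x + 1) - line_poly j k x)
      + ?q * (line_poly j k x - line_poly j k (x - 1))
      = (?p * of_int (line_coeff k (x + 1) - line_coeff k x)
         + ?q * of_int ((-1) ^ k * line_coeff k (- x) - (-1) ^ k * line_coeff k (- (x - 1)))) * ?e ^ k"
    by (simp only: right_diff_distrib L of_int_diff left_diff_distrib distrib_right)
  also have "\<dots> = (?p * of_int (int k * ?b) + ?q * of_int (int k * ?a)) * ?e ^ k"
    by (simp only: a c) simp
  also have "\<dots> = of_nat k * ((?p * ?e * of_int ?b + ?q * ?e * of_int ?a) * ?e ^ l)"
  proof -
    have "u * of_int (int k * z) * ?e ^ k = of_nat k * (u * ?e * of_int z * ?e ^ l)" for u z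
    proof -
      have "u * of_int (int k * z) * ?e ^ k = of_int (int k * z) * (u * ?e * ?e ^ l)"
        by (simp only: comm[symmetric, of u] mult.assoc Suc power_Suc)
      also have "\<dots> = of_nat k * (u * ?e * of_int z * ?e ^ l)"
        unfolding comm[symmetric, of "u * ?e"] by (simp add: mult.assoc)
      finally show ?thesis .
    qed
    then show ?thesis by (simp only: distrib_left distrib_right)
  qed
  also have "(?p * ?e * of_int ?b + ?q * ?e * of_int ?a) = ?q * ?p * of_int ?a + ?p * ?q * of_int ?b"
    by (simp add: e_unit_def distrib_left)
  finally show ?thesis by (simp add: line_poly_def Suc)
qed

section \<open>Signs and products over several variables\<close>

definition anticomm_parity :: "'m::{finite,linorder} clifford \<Rightarrow> nat \<Rightarrow> 'm clifford \<Rightarrow> bool" where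
  "anticomm_parity u k a \<longleftrightarrow> u * a = (-1) ^ k * (a * u)"

lemma anticomm_parity_mult:
  "anticomm_parity u k a \<Longrightarrow> anticomm_parity u l b \<Longrightarrow> anticomm_parity u (k + l) (a * b)"
proof -
  assume "anticomm_parity u k a" "anticomm_parity u l b"
  then have a: "u * a = (-1) ^ k * (a * u)" and b: "u * b = (-1) ^ l * (b * u)"
    by (simp_all add: anticomm_parity_def)
  have "u * (a * b) = (-1) ^ k * (a * (u * b))"
    by (simp only: mult.assoc[symmetric] a)
  then show ?thesis
    unfolding anticomm_parity_def b by (simp add: minus_one_power_iff mult.assoc)
qed

lemma anticomm_parity_add:
  "anticomm_parity u k a \<Longrightarrow> anticomm_parity u k b \<Longrightarrow> anticomm_parity u k (a + b)"
  by (simp add: anticomm_parity_def algebra_simps)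

lemma anticomm_parity_of_int: "anticomm_parity u 0 (of_int z)"
  by (simp add: anticomm_parity_def mult_of_int_commute)

lemma anticomm_parity_power: "anticomm_parity u 1 a \<Longrightarrow> anticomm_parity u k (a ^ k)"
proof (induction k)
  case (Suc k)
  then show ?case using anticomm_parity_mult[of u 1 a k "a ^ k"] by simp
qed (simp add: anticomm_parity_def)

lemma anticomm_parity_line_poly:
  assumes "i \<noteq> j"
  shows "anticomm_parity (e_plus i) k (line_poly j k x)" "anticomm_parity (e_minus i) k (line_poly j k x)"
proof -
  have "anticomm_parity u k (line_poly j k x)"
    if p: "anticomm_parity u 1 (e_plus j)" and q: "anticomm_parity u 1 (e_minus j)" for u
  proof -
    \<comment> \<open>Degree 2 for a product of two Witt generators, 0 for the integer,
      \<open>k\<close> for the power of \<open>e_unit j\<close>; the even part does not affect the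
      sign.\<close>
    have "anticomm_parity u (1 + 1 + 0 + k) (line_poly j k x)"
      unfolding line_poly_def e_unit_def
      by (intro anticomm_parity_mult anticomm_parity_add anticomm_parity_of_int
          anticomm_parity_power p q)
    then show ?thesis by (simp add: anticomm_parity_def)
  qed
  with e_anticommute[OF assms] show "anticomm_parity (e_plus i) k (line_poly j k x)"
    "anticomm_parity (e_minus i) k (line_poly j k x)"
    by (auto simp: anticomm_parity_def)
qed

text \<open>The solution that \<open>basic_fun\<close> describes. The factors do not commute; in
  increasing order exactly those with index below \<open>j\<close> stand left of the
  \<open>j\<close>-th one, and moving a Witt generator past them produces the sign in the defining
  equation.\<close>

definition product_poly :: "'m::{finite,linorder} mindex \<Rightarrow> 'm dfun" where
  "product_poly \<alpha> x = prod_list (map (\<lambda>j. line_poly j (\<alpha> j) (x $ j)) (sorted_list_of_set UNIV))"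

lemma sorted_list_of_UNIV_split:
  fixes j :: "'m::{finite,linorder}"
  obtains ys zs where "sorted_list_of_set UNIV = ys @ j # zs" "set ys = {..<j}" "distinct ys"
    "j \<notin> set ys" "j \<notin> set zs"
proof -
  have "j \<in> set (sorted_list_of_set (UNIV::'m set))" by simp
  then obtain ys zs where s: "sorted_list_of_set UNIV = ys @ j # zs"
    by (meson split_list)
  have d: "distinct (ys @ j # zs)" and so: "sorted (ys @ j # zs)"
    using s[symmetric] by simp_all
  have u: "set ys \<union> insert j (set zs) = UNIV"
    using arg_cong[OF s, of set] by simp
  have "set ys = {..<j}"
  proof
    show "set ys \<subseteq> {..<j}" using d so by (force simp: sorted_append)
    show "{..<j} \<subseteq> set ys" using u so by (force simp: sorted_append)
  qed
  with s d show thesis by (intro that) auto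
qed

lemma product_poly_dpartial:
  "dpartial j (product_poly \<alpha>) x
     = (-1) ^ (\<Sum>i\<in>{..<j}. \<alpha> i) * of_nat (\<alpha> j) * product_poly (\<alpha>(j := \<alpha> j - 1)) x"
proof -
  obtain ys zs where s: "sorted_list_of_set UNIV = ys @ j # zs" and ys: "set ys = {..<j}" "distinct ys"
    and nin: "j \<notin> set ys" "j \<notin> set zs"
    by (rule sorted_list_of_UNIV_split)
  let ?P = "\<lambda>xs \<alpha> x. prod_list (map (\<lambda>j. line_poly j (\<alpha> j) (x $ j)) xs)"
  define Y where "Y = ?P ys \<alpha> x"
  define Z where "Z = ?P zs \<alpha> x"
  have cong: "?P xs \<beta> y = ?P xs \<alpha> x" if "j \<notin> set xs" "\<And>i. i \<noteq> j \<Longrightarrow> \<beta> i = \<alpha> i" "\<And>i. i \<noteq> j \<Longrightarrow> y $ i = x $ i"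
    for xs \<beta> and y :: "(int, 'a) vec"
    using that by (intro arg_cong[of _ _ prod_list] map_cong) (metis (no_types))+
  have P: "product_poly \<beta> y = Y * line_poly j (\<beta> j) (y $ j) * Z"
    if "\<And>i. i \<noteq> j \<Longrightarrow> \<beta> i = \<alpha> i" "\<And>i. i \<noteq> j \<Longrightarrow> y $ i = x $ i" for \<beta> and y :: "(int, 'a) vec"
    using cong[OF nin(1) that] cong[OF nin(2) that]
    by (simp add: product_poly_def s Y_def Z_def mult.assoc)
  have par: "anticomm_parity (e_plus j) (\<Sum>i\<leftarrow>xs. \<alpha> i) (?P xs \<alpha> x) \<and>
      anticomm_parity (e_minus j) (\<Sum>i\<leftarrow>xs. \<alpha> i) (?P xs \<alpha> x)" if "j \<notin> set xs" for xs
    using that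
  proof (induction xs)
    case (Cons i xs)
    then show ?case
      using anticomm_parity_line_poly[of j i "\<alpha> i" "x $ i"] by (auto intro!: anticomm_parity_mult)
  qed (simp add: anticomm_parity_def)
  have sum: "(\<Sum>i\<leftarrow>ys. \<alpha> i) = (\<Sum>i\<in>{..<j}. \<alpha> i)"
    using ys by (metis sum_list_distinct_conv_sum_set)
  let ?n = "\<Sum>i\<in>{..<j}. \<alpha> i"
  have eY: "e_plus j * Y = (-1) ^ ?n * (Y * e_plus j)" "e_minus j * Y = (-1) ^ ?n * (Y * e_minus j)"
    using par[OF nin(1)] by (simp_all add: anticomm_parity_def Y_def sum)
  let ?l = "line_poly j (\<alpha> j)"
  have p: "product_poly \<alpha> (x + axis j 1) = Y * ?l (x $ j + 1) * Z"
    "product_poly \<alpha> (x - axis j 1) = Y * ?l (x $ j - 1) * Z"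
    "product_poly \<alpha> x = Y * ?l (x $ j) * Z"
    by (subst P; simp add: axis_def)+
  have "dpartial j (product_poly \<alpha>) x
    = (e_plus j * Y) * (?l (x $ j + 1) - ?l (x $ j)) * Z + (e_minus j * Y) * (?l (x $ j) - ?l (x $ j - 1)) * Z"
    unfolding dpartial_def dDiff_plus_def dDiff_minus_def p by (simp add: algebra_simps)
  also have "\<dots> = (-1) ^ ?n * (Y * (e_plus j * (?l (x $ j + 1) - ?l (x $ j)) + e_minus j * (?l (x $ j) - ?l (x $ j - 1))) * Z)"
    unfolding eY by (simp add: distrib_left distrib_right mult.assoc)
  also have "\<dots> = (-1) ^ ?n * of_nat (\<alpha> j) * (Y * line_poly j (\<alpha> j - 1) (x $ j) * Z)"
    unfolding line_poly_diff by (simp add: mult.assoc) (metis mult.assoc mult_of_nat_commute)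
  also have "Y * line_poly j (\<alpha> j - 1) (x $ j) * Z = product_poly (\<alpha>(j := \<alpha> j - 1)) x"
    by (subst P) auto
  finally show ?thesis .
qed

lemma product_poly_one: "product_poly (\<lambda>_. 0) x = 1"
  by (simp add: product_poly_def map_replicate_const)

lemma product_poly_at_0:
  assumes "\<alpha> \<noteq> (\<lambda>_. 0)"
  shows "product_poly \<alpha> 0 = 0"
proof -
  obtain j where "\<alpha> j \<noteq> 0" using assms by auto
  obtain ys zs where "sorted_list_of_set UNIV = ys @ j # zs"
    by (rule sorted_list_of_UNIV_split)
  with \<open>\<alpha> j \<noteq> 0\<close> show ?thesis by (simp add: product_poly_def line_poly_at_0)
qed

section \<open>Uniqueness and linear independence\<close>

lemma dpartial_eq_0_imp_shift:
  assumes "\<And>x. dpartial j f x = 0"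
  shows "f (x + axis j 1) = f x"
proof -
  let ?p = "e_plus j" and ?q = "e_minus j"
  have d: "?p * (f (y + axis j 1) - f y) + ?q * (f y - f (y - axis j 1)) = 0" for y
    using assms[of y] by (simp add: dpartial_def dDiff_plus_def dDiff_minus_def)
  \<comment> \<open>Left multiplication by \<open>?q\<close> removes the backward difference, by
    \<open>?p\<close> the forward one. The backward equation is taken at
    \<open>x + axis j 1\<close>, so both compare \<open>f (x + axis j 1)\<close> with
    \<open>f x\<close>, on complementary idempotents.\<close>
  have "?q * ?p * (f (y + axis j 1) - f y) = 0" for y
    using arg_cong[OF d[of y], of "\<lambda>a. ?q * a"]
    by (simp only: distrib_left mult.assoc[symmetric] e_minus_square) simp
  from this[of x] have 1: "?q * ?p * (f (x + axis j 1)) = ?q * ?p * f x"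
    by (simp add: right_diff_distrib)
  have "?p * ?q * (f y - f (y - axis j 1)) = 0" for y
    using arg_cong[OF d[of y], of "\<lambda>a. ?p * a"]
    by (simp only: distrib_left mult.assoc[symmetric] e_plus_square) simp
  from this[of "x + axis j 1"] have 2: "?p * ?q * (f (x + axis j 1)) = ?p * ?q * f x"
    by (simp add: right_diff_distrib)
  have "f y = ?q * ?p * f y + ?p * ?q * f y" for y
    by (simp add: distrib_right[symmetric] e_plus_minus)
  with 1 2 show ?thesis by metis
qed

lemma shift_invariant_imp_const:
  fixes f :: "(int, 'm::finite) vec \<Rightarrow> 'a"
  assumes "\<And>j x. f (x + axis j 1) = f x"
  shows "f x = f 0"
proof -
  have nat: "f (x + axis j (int n)) = f x" for j x n
  proof (induction n)
    case (Suc n)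
    have "x + axis j (int (Suc n)) = (x + axis j (int n)) + axis j 1"
      by (simp add: vec_eq_iff axis_def)
    then show ?case using Suc assms by metis
  next
    case 0
    have "axis j 0 = (0 :: (int, 'm) vec)" by (simp add: vec_eq_iff axis_def)
    then show ?case by (simp only: of_nat_0 add_0_right)
  qed
  have int: "f (x + axis j z) = f x" for j x z
  proof (cases "0 \<le> z")
    case True
    then show ?thesis using nat[of x j "nat z"] by simp
  next
    case False
    have "x = (x + axis j z) + axis j (int (nat (- z)))"
      using False by (simp add: vec_eq_iff axis_def)
    then show ?thesis using nat by metis
  qed
  have shift: "f (axis j z + x) = f x" for j x z
    using int[of x j z] by (simp only: add.commute)
  have "f (\<Sum>j\<in>S. axis j (x $ j)) = f 0" if "finite S" for S
    using that by (induction S) (simp_all add: shift)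
  moreover have "(\<Sum>j\<in>UNIV. axis j (x $ j)) = x"
    by (simp add: vec_eq_iff axis_def)
  ultimately show ?thesis by (metis finite)
qed

lemma dpartial_eq_imp_eq:
  assumes "\<And>j x. dpartial j f x = dpartial j g x" "f 0 = g 0"
  shows "f = g"
proof
  fix x
  let ?h = "\<lambda>x. f x - g x"
  have "dpartial j ?h x = dpartial j f x - dpartial j g x" for j x
    by (simp add: dpartial_def dDiff_plus_def dDiff_minus_def algebra_simps)
  then have "?h x = ?h 0"
    using assms(1) by (intro shift_invariant_imp_const dpartial_eq_0_imp_shift) simp
  with assms(2) show "f x = g x" by simp
qed

lemma mindex_degree_induct [consumes 0, case_names less]:
  fixes \<alpha> :: "'m::finite \<Rightarrow> nat"
  assumes "\<And>\<alpha>. (\<And>j. \<alpha> j \<noteq> 0 \<Longrightarrow> P (\<alpha>(j := \<alpha> j - 1))) \<Longrightarrow> P \<alpha>"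
  shows "P \<alpha>"
proof (induction "\<Sum>i\<in>UNIV. \<alpha> i" arbitrary: \<alpha> rule: less_induct)
  case less
  show ?case
  proof (rule assms)
    fix j assume "\<alpha> j \<noteq> 0"
    then have "(\<Sum>i\<in>UNIV. (\<alpha>(j := \<alpha> j - 1)) i) < (\<Sum>i\<in>UNIV. \<alpha> i)"
      by (intro sum_strict_mono_ex1) auto
    then show "P (\<alpha>(j := \<alpha> j - 1))" by (rule less)
  qed
qed

text \<open>Uniqueness goes by induction on the degree: lower degrees fix all differences of
  \<open>X \<alpha>\<close>, and the value at the origin fixes the remaining constant.\<close>

lemma basic_fun_eq_product_poly: "basic_fun = product_poly"
  unfolding basic_fun_def
proof (rule the_equality)
  fix X :: "'a mindex \<Rightarrow> 'a dfun"
  assume X: "(\<forall>\<alpha> j x. dpartial j (X \<alpha>) x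
         = (-1) ^ (\<Sum>i\<in>{..<j}. \<alpha> i) * of_nat (\<alpha> j) * X (\<alpha>(j := \<alpha> j - 1)) x) \<and>
      (\<forall>x. X (\<lambda>_. 0) x = 1) \<and> (\<forall>\<alpha>. \<alpha> \<noteq> (\<lambda>_. 0) \<longrightarrow> X \<alpha> 0 = 0)"
  have "X \<alpha> = product_poly \<alpha>" for \<alpha>
  proof (induction \<alpha> rule: mindex_degree_induct)
    case (less \<alpha>)
    show ?case
    proof (rule dpartial_eq_imp_eq)
      show "dpartial j (X \<alpha>) x = dpartial j (product_poly \<alpha>) x" for j x
      \<comment> \<open>For \<open>\<alpha> j = 0\<close> the truncated index is
        \<open>\<alpha>\<close> itself, out of reach of the induction hypothesis, but the factor
        \<open>\<alpha> j\<close> annihilates both sides.\<close>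
      proof (cases "\<alpha> j = 0")
        case True
        with X show ?thesis by (simp add: product_poly_dpartial)
      next
        case False
        have "X (\<alpha>(j := \<alpha> j - 1)) = product_poly (\<alpha>(j := \<alpha> j - 1))"
          using less False by blast
        with X show ?thesis by (simp only: product_poly_dpartial)
      qed
      show "X \<alpha> 0 = product_poly \<alpha> 0"
        using X by (cases "\<alpha> = (\<lambda>_. 0)") (auto simp: product_poly_one product_poly_at_0)
    qed
  qed
  then show "X = product_poly" by auto
qed (simp add: product_poly_dpartial product_poly_one product_poly_at_0)

lemmas basic_fun_dpartial = product_poly_dpartial[folded basic_fun_eq_product_poly]
  and basic_fun_one = product_poly_one[folded basic_fun_eq_product_poly]
  and basic_fun_at_0 = product_poly_at_0[folded basic_fun_eq_product_poly]

text \<open>Applying \<open>dpartial j\<close> to a vanishing combination gives another one, in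
  which \<open>c \<alpha>\<close> appears, up to a nonzero integer factor, at the index lowered in
  \<open>j\<close>. Descending in this way turns every coefficient into a constant term, which
  evaluation at the origin isolates.\<close>

lemma basic_fun_independent:
  assumes "finite {\<alpha>. c \<alpha> \<noteq> 0}" "\<And>x. (\<Sum>\<alpha> | c \<alpha> \<noteq> 0. basic_fun \<alpha> x * c \<alpha>) = 0"
  shows "c \<beta> = 0"
  using assms
proof (induction \<beta> arbitrary: c rule: mindex_degree_induct)
  case (less \<beta> c)
  let ?S = "{\<alpha>. c \<alpha> \<noteq> 0}"
  show ?case
  proof (cases "\<beta> = (\<lambda>_. 0)")
    case True
    have "(\<Sum>\<alpha>\<in>?S. basic_fun \<alpha> 0 * c \<alpha>) = (\<Sum>\<alpha>\<in>?S. if \<alpha> = \<beta> then c \<beta> else 0)"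
      by (rule sum.cong) (auto simp: basic_fun_one basic_fun_at_0 True)
    then show ?thesis using less.prems by (auto split: if_splits)
  next
    case False
    then obtain j where j: "\<beta> j \<noteq> 0" by auto
    define d :: "'a mindex \<Rightarrow> 'a clifford" where
      "d \<alpha> = (-1) ^ (\<Sum>i\<in>{..<j}. \<alpha> i) * of_nat (\<alpha> j + 1) * c (\<alpha>(j := \<alpha> j + 1))" for \<alpha>
    let ?T = "{\<alpha> \<in> ?S. \<alpha> j \<noteq> 0}"
    let ?down = "\<lambda>\<alpha>::'a mindex. \<alpha>(j := \<alpha> j - 1)"
    have fT: "finite ?T" using less.prems(1) by simp
    have inj: "inj_on ?down ?T"
      by (rule inj_on_inverseI[of _ "\<lambda>\<alpha>. \<alpha>(j := \<alpha> j + 1)"]) auto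
    have dd: "d (?down \<alpha>) = (-1) ^ (\<Sum>i\<in>{..<j}. \<alpha> i) * of_nat (\<alpha> j) * c \<alpha>" if "\<alpha> j \<noteq> 0" for \<alpha>
    proof -
      have "(\<Sum>i\<in>{..<j}. ?down \<alpha> i) = (\<Sum>i\<in>{..<j}. \<alpha> i)" by (rule sum.cong) auto
      with that show ?thesis by (simp only: d_def) simp
    qed
    have sub: "{\<alpha>. d \<alpha> \<noteq> 0} \<subseteq> ?down ` ?T"
    proof
      fix \<alpha> assume "\<alpha> \<in> {\<alpha>. d \<alpha> \<noteq> 0}"
      then have "c (\<alpha>(j := \<alpha> j + 1)) \<noteq> 0" by (auto simp: d_def)
      then show "\<alpha> \<in> ?down ` ?T" by (intro image_eqI[of _ _ "\<alpha>(j := \<alpha> j + 1)"]) auto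
    qed
    have "d (?down \<beta>) = 0"
    proof (rule less.IH[OF j])
      show "finite {\<alpha>. d \<alpha> \<noteq> 0}" using sub fT by (meson finite_surj)
      fix x
      have "0 = dpartial j (\<lambda>x. \<Sum>\<alpha>\<in>?S. basic_fun \<alpha> x * c \<alpha>) x"
        by (simp add: less.prems(2) dpartial_def dDiff_plus_def dDiff_minus_def)
      also have "\<dots> = (\<Sum>\<alpha>\<in>?S. dpartial j (basic_fun \<alpha>) x * c \<alpha>)"
        by (simp add: dpartial_def dDiff_plus_def dDiff_minus_def sum_distrib_left
            sum_distrib_right algebra_simps sum.distrib sum_subtractf)
      also have "\<dots> = (\<Sum>\<alpha>\<in>?T. dpartial j (basic_fun \<alpha>) x * c \<alpha>)"
        by (rule sum.mono_neutral_right[OF less.prems(1)]) (auto simp: basic_fun_dpartial intro!: gr0I)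
      also have "\<dots> = (\<Sum>\<alpha>\<in>?T. basic_fun (?down \<alpha>) x * d (?down \<alpha>))"
      proof (rule sum.cong[OF refl])
        fix \<alpha> assume "\<alpha> \<in> ?T"
        then have "basic_fun (?down \<alpha>) x * d (?down \<alpha>)
          = basic_fun (?down \<alpha>) x * (of_int ((-1) ^ (\<Sum>i\<in>{..<j}. \<alpha> i) * int (\<alpha> j))) * c \<alpha>"
          using dd[of \<alpha>] by (simp add: mult.assoc)
        also have "\<dots> = dpartial j (basic_fun \<alpha>) x * c \<alpha>"
          by (subst mult_of_int_commute[symmetric]) (simp add: basic_fun_dpartial)
        finally show "dpartial j (basic_fun \<alpha>) x * c \<alpha> = basic_fun (?down \<alpha>) x * d (?down \<alpha>)" ..
      qed
      also have "\<dots> = (\<Sum>\<alpha>\<in>?down ` ?T. basic_fun \<alpha> x * d \<alpha>)"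
        by (simp only: sum.reindex[OF inj] o_def)
      also have "\<dots> = (\<Sum>\<alpha> | d \<alpha> \<noteq> 0. basic_fun \<alpha> x * d \<alpha>)"
        using fT sub by (intro sum.mono_neutral_right) auto
      finally show "(\<Sum>\<alpha> | d \<alpha> \<noteq> 0. basic_fun \<alpha> x * d \<alpha>) = 0" ..
    qed
    then have "of_int ((-1) ^ (\<Sum>i\<in>{..<j}. \<beta> i)) * of_int (int (\<beta> j)) * c \<beta> = 0"
      using dd[of \<beta>] j by simp
    \<comment> \<open>The Clifford algebra has zero divisors, so the integer factor is cancelled as
      a real scalar.\<close>
    then have "real_of_int ((-1) ^ (\<Sum>i\<in>{..<j}. \<beta> i) * int (\<beta> j)) *\<^sub>R c \<beta> = 0"
      by (simp add: scaleR_conv_of_real)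
    then show ?thesis using j by simp
  qed
qed


section \<open>Right linear operators\<close>

lemma dpoly_eqI: "(\<And>x. poly_fun f x = poly_fun g x) \<Longrightarrow> f = g"
  by (simp add: poly_fun_inject[symmetric] fun_eq_iff)

lemma poly_fun_sum: "poly_fun (sum g S) x = (\<Sum>i\<in>S. poly_fun (g i) x)"
  by (induction S rule: infinite_finite_induct) (simp_all add: zero_dpoly.rep_eq plus_dpoly.rep_eq)

lemma poly_fun_minus: "poly_fun (f - g) x = poly_fun f x - poly_fun g x"
  unfolding minus_dpoly_def plus_dpoly.rep_eq uminus_dpoly.rep_eq by simp

lemmas poly_fun_simps = zero_dpoly.rep_eq plus_dpoly.rep_eq uminus_dpoly.rep_eq poly_fun_minus
  scaleR_dpoly.rep_eq rmult.rep_eq basic_poly.rep_eq poly_fun_sum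

lemma rmult_simps [simp]:
  "rmult 0 a = 0" "rmult f 0 = 0" "rmult f 1 = f" "rmult (- f) a = - rmult f a"
  "rmult f (- a) = - rmult f a" "rmult (rmult f a) b = rmult f (a * b)"
  by (rule dpoly_eqI; simp add: poly_fun_simps mult.assoc)+

lemma rmult_distrib:
  "rmult (f + g) a = rmult f a + rmult g a" "rmult f (a + b) = rmult f a + rmult f b"
  "rmult (f - g) a = rmult f a - rmult g a"
  by (rule dpoly_eqI; simp add: poly_fun_simps algebra_simps)+

lemma rmult_scaleR: "rmult (r *\<^sub>R f) a = r *\<^sub>R rmult f a" "rmult f (r *\<^sub>R a) = r *\<^sub>R rmult f a"
  by (rule dpoly_eqI; simp add: poly_fun_simps)+

lemma rmult_sum: "rmult (sum g S) a = (\<Sum>i\<in>S. rmult (g i) a)"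
  by (rule dpoly_eqI) (simp add: poly_fun_simps sum_distrib_right)

lemma scaleR_eq_rmult: "r *\<^sub>R f = rmult f (of_real r)"
  by (rule dpoly_eqI) (simp add: poly_fun_simps of_real_def)

lemma cconst_of_real: "cconst (of_real r) = (of_real r :: 'm::{finite,linorder} clifford)"
proof -
  have "coord (cconst (of_real r) :: 'm clifford) A = coord (r *\<^sub>R 1) A" for A
    unfolding cconst.rep_eq scaleR_clifford.rep_eq one_clifford.rep_eq
    by (simp add: scaleR_conv_of_real)
  then show ?thesis by (simp add: coord_inject[symmetric] fun_eq_iff of_real_def)
qed

lemma cscale_of_real: "cscale (of_real r) f = r *\<^sub>R f"
  by (simp add: cscale_def cconst_of_real scaleR_eq_rmult)

lemma cscale_simps [simp]:
  "cscale z (cscale w f) = cscale (z * w) f" "cscale 1 f = f" "cscale 0 f = 0" "cscale z 0 = 0"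
  by (simp_all add: cscale_def cconst_mult mult.commute)

lemma cscale_distrib:
  "cscale z (f + g) = cscale z f + cscale z g" "cscale z (f - g) = cscale z f - cscale z g"
  "cscale (z + w) f = cscale z f + cscale w f" "cscale (z - w) f = cscale z f - cscale w f"
  "cscale z (- f) = - cscale z f" "cscale (- z) f = - cscale z f"
proof -
  show add: "cscale (z + w) f = cscale z f + cscale w f" for z w
    by (simp add: cscale_def rmult_distrib cconst_add[symmetric])
  show minus: "cscale (- z) f = - cscale z f" for z
    by (simp add: cscale_def cconst_minus)
  show "cscale (z - w) f = cscale z f - cscale w f"
    using add[of z "- w"] by (simp add: minus)
qed (simp_all add: cscale_def rmult_distrib)

lemma cscale_scaleR: "cscale z (r *\<^sub>R f) = r *\<^sub>R cscale z f"
  by (simp add: cscale_def rmult_scaleR)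

lemma rmult_cscale: "rmult (cscale z f) a = cscale z (rmult f a)"
  by (simp add: cscale_def cconst_central)

lemma dpoly_expansion:
  "\<exists>c. finite {\<alpha>. c \<alpha> \<noteq> 0} \<and> f = (\<Sum>\<alpha> | c \<alpha> \<noteq> 0. rmult (basic_poly \<alpha>) (c \<alpha>))"
proof -
  obtain c where "finite {\<alpha>. c \<alpha> \<noteq> 0}" "poly_fun f = (\<lambda>x. \<Sum>\<alpha> | c \<alpha> \<noteq> 0. basic_fun \<alpha> x * c \<alpha>)"
    using poly_fun[of f] by auto
  then show ?thesis
    by (intro exI[of _ c] conjI dpoly_eqI) (simp_all add: poly_fun_simps)
qed

lemma dpoly_expansion_unique:
  assumes c: "finite {\<alpha>. c \<alpha> \<noteq> 0}" "f = (\<Sum>\<alpha> | c \<alpha> \<noteq> 0. rmult (basic_poly \<alpha>) (c \<alpha>))"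
    and d: "finite {\<alpha>. d \<alpha> \<noteq> 0}" "f = (\<Sum>\<alpha> | d \<alpha> \<noteq> 0. rmult (basic_poly \<alpha>) (d \<alpha>))"
  shows "c = d"
proof
  fix \<beta>
  let ?S = "{\<alpha>. c \<alpha> \<noteq> 0} \<union> {\<alpha>. d \<alpha> \<noteq> 0}"
  let ?e = "\<lambda>\<alpha>. c \<alpha> - d \<alpha>"
  have fin: "finite ?S" using c(1) d(1) by simp
  have "f = (\<Sum>\<alpha>\<in>?S. rmult (basic_poly \<alpha>) (c \<alpha>))" "f = (\<Sum>\<alpha>\<in>?S. rmult (basic_poly \<alpha>) (d \<alpha>))"
    by (subst c(2), rule sum.mono_neutral_left[OF fin], auto)
      (subst d(2), rule sum.mono_neutral_left[OF fin], auto)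
  then have "(\<Sum>\<alpha>\<in>?S. rmult (basic_poly \<alpha>) (c \<alpha>)) = (\<Sum>\<alpha>\<in>?S. rmult (basic_poly \<alpha>) (d \<alpha>))" by simp
  from arg_cong[OF this, of poly_fun]
  have "(\<Sum>\<alpha>\<in>?S. basic_fun \<alpha> x * c \<alpha>) = (\<Sum>\<alpha>\<in>?S. basic_fun \<alpha> x * d \<alpha>)" for x
    by (simp only: fun_eq_iff poly_fun_simps)
  then have 0: "(\<Sum>\<alpha>\<in>?S. basic_fun \<alpha> x * ?e \<alpha>) = 0" for x
    by (simp add: right_diff_distrib sum_subtractf)
  have sub: "{\<alpha>. ?e \<alpha> \<noteq> 0} \<subseteq> ?S" by auto
  have "?e \<beta> = 0"
  proof (rule basic_fun_independent)
    show "finite {\<alpha>. ?e \<alpha> \<noteq> 0}" using sub fin by (rule finite_subset)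
    fix x
    have "(\<Sum>\<alpha> | ?e \<alpha> \<noteq> 0. basic_fun \<alpha> x * ?e \<alpha>) = (\<Sum>\<alpha>\<in>?S. basic_fun \<alpha> x * ?e \<alpha>)"
      by (rule sum.mono_neutral_left[OF fin sub]) auto
    then show "(\<Sum>\<alpha> | ?e \<alpha> \<noteq> 0. basic_fun \<alpha> x * ?e \<alpha>) = 0"
      by (simp only: 0)
  qed
  then show "c \<beta> = d \<beta>" by simp
qed

lemma dcoeff_expansion:
  shows "finite {\<alpha>. dcoeff f \<alpha> \<noteq> 0}"
    and "(\<Sum>\<alpha> | dcoeff f \<alpha> \<noteq> 0. rmult (basic_poly \<alpha>) (dcoeff f \<alpha>)) = f"
proof -
  have "\<exists>!c. finite {\<alpha>. c \<alpha> \<noteq> 0} \<and> f = (\<Sum>\<alpha> | c \<alpha> \<noteq> 0. rmult (basic_poly \<alpha>) (c \<alpha>))"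
    by (rule ex_ex1I[OF dpoly_expansion]) (elim conjE, rule dpoly_expansion_unique)
  note * = theI'[OF this, folded dcoeff_def]
  show "finite {\<alpha>. dcoeff f \<alpha> \<noteq> 0}"
    by (rule conjunct1[OF *])
  show "(\<Sum>\<alpha> | dcoeff f \<alpha> \<noteq> 0. rmult (basic_poly \<alpha>) (dcoeff f \<alpha>)) = f"
    by (rule conjunct2[OF *, symmetric])
qed

lemma dcoeff_eqI:
  assumes "finite S" "f = (\<Sum>\<alpha>\<in>S. rmult (basic_poly \<alpha>) (c \<alpha>))" "\<And>\<alpha>. \<alpha> \<notin> S \<Longrightarrow> c \<alpha> = 0"
  shows "dcoeff f = c"
proof (rule dpoly_expansion_unique)
  have sub: "{\<alpha>. c \<alpha> \<noteq> 0} \<subseteq> S" using assms(3) by auto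
  then show "finite {\<alpha>. c \<alpha> \<noteq> 0}" using assms(1) by (rule finite_subset)
  show "f = (\<Sum>\<alpha> | c \<alpha> \<noteq> 0. rmult (basic_poly \<alpha>) (c \<alpha>))"
    unfolding assms(2) by (rule sum.mono_neutral_right[OF assms(1) sub]) auto
qed (simp_all add: dcoeff_expansion)

lemma dcoeff_expansion_on:
  assumes "finite S" "{\<alpha>. dcoeff f \<alpha> \<noteq> 0} \<subseteq> S"
  shows "f = (\<Sum>\<alpha>\<in>S. rmult (basic_poly \<alpha>) (dcoeff f \<alpha>))"
proof -
  have "(\<Sum>\<alpha> | dcoeff f \<alpha> \<noteq> 0. rmult (basic_poly \<alpha>) (dcoeff f \<alpha>))
    = (\<Sum>\<alpha>\<in>S. rmult (basic_poly \<alpha>) (dcoeff f \<alpha>))"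
    by (rule sum.mono_neutral_left[OF assms]) auto
  then show ?thesis by (simp add: dcoeff_expansion)
qed

lemma dcoeff_basic_poly: "dcoeff (basic_poly \<beta>) = (\<lambda>\<alpha>. if \<alpha> = \<beta> then 1 else 0)"
  by (rule dcoeff_eqI[of "{\<beta>}"]) auto

lemma dcoeff_add: "dcoeff (f + g) = (\<lambda>\<alpha>. dcoeff f \<alpha> + dcoeff g \<alpha>)"
proof -
  let ?S = "{\<alpha>. dcoeff f \<alpha> \<noteq> 0} \<union> {\<alpha>. dcoeff g \<alpha> \<noteq> 0}"
  have S: "finite ?S" by (simp add: dcoeff_expansion)
  have "f = (\<Sum>\<alpha>\<in>?S. rmult (basic_poly \<alpha>) (dcoeff f \<alpha>))"
    "g = (\<Sum>\<alpha>\<in>?S. rmult (basic_poly \<alpha>) (dcoeff g \<alpha>))"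
    by (intro dcoeff_expansion_on[OF S]; auto)+
  from arg_cong2[OF this, of "(+)"]
  have "f + g = (\<Sum>\<alpha>\<in>?S. rmult (basic_poly \<alpha>) (dcoeff f \<alpha> + dcoeff g \<alpha>))"
    by (simp only: rmult_distrib sum.distrib)
  then show ?thesis by (rule dcoeff_eqI[OF S]) simp
qed

lemma dcoeff_rmult: "dcoeff (rmult f a) = (\<lambda>\<alpha>. dcoeff f \<alpha> * a)"
proof -
  have "rmult (\<Sum>\<alpha> | dcoeff f \<alpha> \<noteq> 0. rmult (basic_poly \<alpha>) (dcoeff f \<alpha>)) a = rmult f a"
    by (simp only: dcoeff_expansion(2))
  then have "rmult f a = (\<Sum>\<alpha> | dcoeff f \<alpha> \<noteq> 0. rmult (basic_poly \<alpha>) (dcoeff f \<alpha> * a))"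
    by (simp only: rmult_sum rmult_simps)
  then show ?thesis by (rule dcoeff_eqI[OF dcoeff_expansion(1)]) simp
qed

lemma rlinear_ext_on:
  assumes "finite S" "{\<alpha>. dcoeff f \<alpha> \<noteq> 0} \<subseteq> S"
  shows "rlinear_ext B f = (\<Sum>\<alpha>\<in>S. rmult (B \<alpha>) (dcoeff f \<alpha>))"
  unfolding rlinear_ext_def by (rule sum.mono_neutral_left[OF assms]) auto

text \<open>Real and complex scaling are right multiplications by constants, so these two conditions
  include linearity over both.\<close>

definition right_linear :: "'m::{finite,linorder} dop \<Rightarrow> bool" where
  "right_linear X \<longleftrightarrow> (\<forall>f g. X (f + g) = X f + X g) \<and> (\<forall>f a. X (rmult f a) = rmult (X f) a)"

lemma right_linear_rlinear_ext: "right_linear (rlinear_ext B)"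
  unfolding right_linear_def
proof (intro conjI allI)
  fix f g :: "'a dpoly"
  let ?S = "{\<alpha>. dcoeff f \<alpha> \<noteq> 0} \<union> {\<alpha>. dcoeff g \<alpha> \<noteq> 0}"
  have S: "finite ?S" by (simp add: dcoeff_expansion)
  have "rlinear_ext B h = (\<Sum>\<alpha>\<in>?S. rmult (B \<alpha>) (dcoeff h \<alpha>))" if "h \<in> {f, g, f + g}" for h
    using that by (intro rlinear_ext_on[OF S]) (auto simp: dcoeff_add)
  then show "rlinear_ext B (f + g) = rlinear_ext B f + rlinear_ext B g"
    by (simp add: dcoeff_add rmult_distrib sum.distrib)
next
  fix f a
  show "rlinear_ext B (rmult f a) = rmult (rlinear_ext B f) a"
    using rlinear_ext_on[OF dcoeff_expansion(1)[of f], of "rmult f a" B]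
    by (simp add: dcoeff_rmult rlinear_ext_def[of B f] rmult_sum Collect_mono_iff)
      (metis mult_zero_left)
qed

lemma rlinear_ext_basic_poly [simp]: "rlinear_ext B (basic_poly \<alpha>) = B \<alpha>"
  by (simp add: rlinear_ext_def dcoeff_basic_poly)

context
  fixes X :: "'m::{finite,linorder} dop"
  assumes X: "right_linear X"
begin

lemma right_linear_add: "X (f + g) = X f + X g"
  and right_linear_rmult: "X (rmult f a) = rmult (X f) a"
  using X by (auto simp: right_linear_def)

lemma right_linear_0: "X 0 = 0"
  using right_linear_rmult[of 0 0] by simp

lemma right_linear_uminus: "X (- f) = - X f"
  using right_linear_rmult[of f "- 1"] by simp

lemma right_linear_minus: "X (f - g) = X f - X g"
  by (simp only: diff_conv_add_uminus right_linear_add right_linear_uminus)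

lemma right_linear_scaleR: "X (r *\<^sub>R f) = r *\<^sub>R X f"
  by (simp add: scaleR_eq_rmult right_linear_rmult)

lemma right_linear_cscale: "X (cscale z f) = cscale z (X f)"
  by (simp add: cscale_def right_linear_rmult)

lemma right_linear_sum: "X (sum g S) = (\<Sum>i\<in>S. X (g i))"
  by (induction S rule: infinite_finite_induct) (simp_all add: right_linear_0 right_linear_add)

end

lemmas right_linear_simps = right_linear_add right_linear_0 right_linear_uminus right_linear_minus
  right_linear_scaleR right_linear_cscale right_linear_sum right_linear_rmult

lemma right_linear_eqI:
  assumes "right_linear X" "right_linear Y" "\<And>\<alpha>. X (basic_poly \<alpha>) = Y (basic_poly \<alpha>)"
  shows "X f = Y f"
proof -
  have "X (\<Sum>\<alpha> | dcoeff f \<alpha> \<noteq> 0. rmult (basic_poly \<alpha>) (dcoeff f \<alpha>))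
    = Y (\<Sum>\<alpha> | dcoeff f \<alpha> \<noteq> 0. rmult (basic_poly \<alpha>) (dcoeff f \<alpha>))"
    by (simp only: right_linear_sum[OF assms(1)] right_linear_sum[OF assms(2)]
        right_linear_rmult[OF assms(1)] right_linear_rmult[OF assms(2)] assms(3))
  then show ?thesis by (simp add: dcoeff_expansion)
qed

named_theorems right_linear_intros

lemma right_linear_id [right_linear_intros]: "right_linear (\<lambda>f. f)" "right_linear id"
  by (simp_all add: right_linear_def)

lemma right_linear_compose:
  "right_linear X \<Longrightarrow> right_linear Y \<Longrightarrow> right_linear (\<lambda>f. X (Y f))"
  by (simp add: right_linear_def)

lemma right_linear_o [right_linear_intros]:
  "right_linear X \<Longrightarrow> right_linear Y \<Longrightarrow> right_linear (X \<circ> Y)"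
  by (simp add: right_linear_def)

lemma right_linear_arith [right_linear_intros]:
  "right_linear X \<Longrightarrow> right_linear Y \<Longrightarrow> right_linear (\<lambda>f. X f + Y f)"
  "right_linear X \<Longrightarrow> right_linear Y \<Longrightarrow> right_linear (\<lambda>f. X f - Y f)"
  "right_linear X \<Longrightarrow> right_linear (\<lambda>f. - X f)"
  "right_linear X \<Longrightarrow> right_linear (\<lambda>f. r *\<^sub>R X f)"
  "right_linear X \<Longrightarrow> right_linear (\<lambda>f. cscale z (X f))"
  by (simp_all add: right_linear_def rmult_distrib rmult_scaleR scaleR_add_right cscale_distrib
      rmult_cscale)

lemma right_linear_sum_op [right_linear_intros]:
  "(\<And>i. i \<in> S \<Longrightarrow> right_linear (X i)) \<Longrightarrow> right_linear (\<lambda>f. \<Sum>i\<in>S. X i f)"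
  by (simp add: right_linear_def rmult_sum sum.distrib)

lemma right_linear_funpow [right_linear_intros]: "right_linear X \<Longrightarrow> right_linear (X ^^ n)"
  by (induction n) (simp_all add: right_linear_def)


section \<open>Relations between the operators\<close>

lemma xi_basic_poly:
  "xi_op j (basic_poly \<alpha>) = (-1) ^ (\<Sum>i\<in>{..<j}. \<alpha> i) *\<^sub>R basic_poly (\<alpha>(j := \<alpha> j + 1))"
  by (simp add: xi_op_def)

lemma sum_remove_UNIV: "(\<Sum>i\<in>UNIV. \<alpha> i) - \<alpha> j = (\<Sum>i\<in>- {j}. \<alpha> i)" for \<alpha> :: "'m::finite \<Rightarrow> nat"
  by (subst sum.remove[of _ j]) (auto simp: Compl_eq_Diff_UNIV)

lemma R_basic_poly:
  "R_op j (basic_poly \<alpha>) = (-1) ^ (\<Sum>i\<in>- {j}. \<alpha> i) *\<^sub>R rmult (basic_poly \<alpha>) (e_unit j)"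
  by (simp add: R_op_def sum_remove_UNIV)

lemma right_linear_xi_op: "right_linear (xi_op j)"
  unfolding xi_op_def by (rule right_linear_rlinear_ext)

lemma right_linear_R_op: "right_linear (R_op j)"
  unfolding R_op_def by (rule right_linear_rlinear_ext)

lemmas [right_linear_intros] =
  right_linear_compose[OF right_linear_xi_op] right_linear_compose[OF right_linear_R_op]

lemmas R_linear = right_linear_simps[OF right_linear_R_op]
  and xi_linear = right_linear_simps[OF right_linear_xi_op]

text \<open>Raising \<open>\<alpha>\<close> at \<open>b\<close> changes the sign exponent of
  \<open>xi_op a\<close> by one exactly when \<open>b < a\<close>, so for distinct indices just one
  of the two orders picks up an additional sign.\<close>

lemma xi_anticommute:
  assumes "j \<noteq> k"
  shows "xi_op j (xi_op k f) = - xi_op k (xi_op j f)"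
proof (rule right_linear_eqI[of "\<lambda>f. xi_op j (xi_op k f)" "\<lambda>f. - xi_op k (xi_op j f)"])
  fix \<alpha> :: "'a mindex"
  have s: "(\<Sum>i\<in>{..<a}. (\<alpha>(b := Suc (\<alpha> b))) i) = (\<Sum>i\<in>{..<a}. \<alpha> i) + (if b < a then 1 else 0)" for a b
    by (subst sum.cong[OF refl, of _ _ "\<lambda>i. \<alpha> i + (if i = b then 1 else 0)"])
      (auto simp: sum.distrib)
  show "xi_op j (xi_op k (basic_poly \<alpha>)) = - xi_op k (xi_op j (basic_poly \<alpha>))"
    using assms
    by (cases "j < k")
      (auto simp: xi_basic_poly xi_linear s fun_upd_twist[OF assms] mult.commute
        simp del: fun_upd_apply, simp_all)
qed (intro right_linear_intros)+

lemma R_anticommute: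
  assumes "j \<noteq> k"
  shows "R_op j (R_op k f) = - R_op k (R_op j f)"
  by (rule right_linear_eqI[of "\<lambda>f. R_op j (R_op k f)" "\<lambda>f. - R_op k (R_op j f)"];
      (intro right_linear_intros)?)
    (simp add: R_basic_poly R_linear e_unit_anticommute[OF assms] rmult_scaleR mult.commute)

lemma R_square [simp]: "R_op j (R_op j f) = f"
  by (rule right_linear_eqI[of "\<lambda>f. R_op j (R_op j f)" "\<lambda>f. f"]; (intro right_linear_intros)?)
    (simp add: R_basic_poly R_linear rmult_scaleR power_mult_distrib[symmetric])

text \<open>This exponent is the sign of \<open>R_op j\<close>. It changes parity exactly when
  \<open>k \<noteq> j\<close>, which is why \<open>R_op j\<close> commutes with
  \<open>xi_op j\<close> and anticommutes with every other \<open>xi_op k\<close>.\<close>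

lemma R_xi_basic_sum:
  "(\<Sum>i\<in>- {j}. (\<alpha>(k := Suc (\<alpha> k))) i) = (\<Sum>i\<in>- {j}. \<alpha> i) + (if k = j then 0 else 1)"
  for \<alpha> :: "'m::finite \<Rightarrow> nat"
  by (subst sum.cong[OF refl, of _ _ "\<lambda>i. \<alpha> i + (if i = k then 1 else 0)"])
    (auto simp: sum.distrib)

lemma R_xi_commute: "R_op j (xi_op j f) = xi_op j (R_op j f)"
  by (rule right_linear_eqI[of "\<lambda>f. R_op j (xi_op j f)" "\<lambda>f. xi_op j (R_op j f)"];
      (intro right_linear_intros)?)
    (simp add: R_basic_poly xi_basic_poly R_linear xi_linear R_xi_basic_sum rmult_scaleR mult.commute
      del: fun_upd_apply)

lemma R_xi_anticommute:
  assumes "j \<noteq> k"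
  shows "R_op j (xi_op k f) = - xi_op k (R_op j f)"
  using assms
  by (intro right_linear_eqI[of "\<lambda>f. R_op j (xi_op k f)" "\<lambda>f. - xi_op k (R_op j f)" f];
      (intro right_linear_intros)?)
    (simp add: R_basic_poly xi_basic_poly R_linear xi_linear R_xi_basic_sum rmult_scaleR mult.commute
      del: fun_upd_apply)

definition chi :: "'m::{finite,linorder} \<Rightarrow> 'm dop" where
  "chi j f = R_op j (xi_op j f)"

lemma right_linear_chi: "right_linear (chi j)"
  unfolding chi_def by (intro right_linear_intros)

lemmas [right_linear_intros] = right_linear_compose[OF right_linear_chi]

lemmas chi_linear = right_linear_simps[OF right_linear_chi]

lemma xi_op_eq_chi: "xi_op j f = R_op j (chi j f)"
  by (simp add: chi_def)

lemma chi_R_commute: "chi j (R_op k f) = R_op k (chi j f)"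
proof (cases "j = k")
  case False
  then have "xi_op j (R_op k f) = - R_op k (xi_op j f)"
    by (simp add: R_xi_anticommute)
  then show ?thesis
    by (simp add: chi_def R_linear R_anticommute[OF False])
qed (simp add: chi_def R_xi_commute)

text \<open>For distinct indices \<open>xi_op k\<close> anticommutes with both factors of
  \<open>chi j\<close>, and the signs cancel.\<close>

lemma chi_chi_commute: "chi j (chi k f) = chi k (chi j f)"
proof (cases "j = k")
  case False
  have "chi j (chi k f) = R_op k (chi j (xi_op k f))"
    by (simp only: chi_def[of k] chi_R_commute)
  also have "chi j (xi_op k f) = xi_op k (chi j f)"
    using False by (simp add: chi_def xi_anticommute[OF False] R_linear R_xi_anticommute)
  finally show ?thesis by (simp add: chi_def)
qed simp


section \<open>Conjugation\<close>

definition conj_sign :: "('m::{finite,linorder} \<times> bool) set \<Rightarrow> complex" where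
  "conj_sign A = (\<Prod>a\<in>A. - 1) * reorder_sign A A"

text \<open>
  The antiautomorphism that negates all generators, since \<open>g\<^sub>A g\<^sub>A = reorder_sign A A\<close>.
\<close>

definition cliff_conj :: "'m::{finite,linorder} clifford \<Rightarrow> 'm clifford" where
  "cliff_conj a = Clifford (\<lambda>A. conj_sign A * coord a A)"

lemma coord_cliff_conj: "coord (cliff_conj a) A = conj_sign A * coord a A"
  by (simp add: cliff_conj_def Clifford_inverse)

lemma reorder_sign_square: "reorder_sign A B * reorder_sign A B = 1"
  for A B :: "('m::{finite,linorder} \<times> bool) set"
  unfolding reorder_sign_def by (auto simp: prod.distrib[symmetric] intro!: prod.neutral)

text \<open>Antimultiplicativity of the conjugation on blades. By bimultiplicativity
  \<open>reorder_sign\<close> of the symmetric difference with itself contains both mixed signs, and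
  \<open>reorder_sign A B\<close> squares away.\<close>

lemma conj_sign_sym_diff:
  fixes A B :: "('m::{finite,linorder} \<times> bool) set"
  shows "reorder_sign A B * conj_sign (sym_diff A B) = reorder_sign B A * (conj_sign B * conj_sign A)"
proof -
  have "(\<Prod>a\<in>sym_diff A B. - 1 :: complex) = (\<Prod>a\<in>A. - 1) * (\<Prod>a\<in>B. - 1)"
    by (rule prod_sign_sym_diff) auto
  then have "reorder_sign A B * conj_sign (sym_diff A B)
    = (reorder_sign A B * reorder_sign A B) * (reorder_sign B A * (conj_sign B * conj_sign A))"
    unfolding conj_sign_def reorder_sign_sym_diff_left reorder_sign_sym_diff_right
    by (simp only: mult_ac)
  then show ?thesis by (simp only: reorder_sign_square mult_1_left)
qed

lemma cliff_conj_mult: "cliff_conj (a * b) = cliff_conj b * cliff_conj a"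
proof (rule coord_inject[THEN iffD1], rule ext)
  fix C :: "('a \<times> bool) set"
  have bij: "bij_betw (\<lambda>A. sym_diff A C) UNIV UNIV"
    by (rule bij_betwI[of _ _ _ "\<lambda>A. sym_diff A C"]) auto
  have canc: "sym_diff (sym_diff A C) C = A" "sym_diff A (sym_diff A C) = C" for A by auto
  have "coord (cliff_conj b * cliff_conj a) C
    = (\<Sum>B\<in>UNIV. reorder_sign B (sym_diff B C) * (conj_sign B * coord b B)
        * (conj_sign (sym_diff B C) * coord a (sym_diff B C)))"
    by (simp add: times_clifford.rep_eq coord_cliff_conj)
  also have "\<dots> = (\<Sum>A\<in>UNIV. reorder_sign (sym_diff A C) A * (conj_sign (sym_diff A C) * coord b (sym_diff A C))
        * (conj_sign A * coord a A))"
    by (subst sum.reindex_bij_betw[OF bij, symmetric]) (simp only: canc)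
  also have "\<dots> = (\<Sum>A\<in>UNIV. conj_sign C * (reorder_sign A (sym_diff A C) * coord a A * coord b (sym_diff A C)))"
  proof (rule sum.cong[OF refl])
    fix A :: "('a \<times> bool) set"
    let ?B = "sym_diff A C"
    have "reorder_sign ?B A * (conj_sign ?B * coord b ?B) * (conj_sign A * coord a A)
      = (reorder_sign ?B A * (conj_sign ?B * conj_sign A)) * (coord a A * coord b ?B)"
      by (simp only: mult_ac)
    also have "reorder_sign ?B A * (conj_sign ?B * conj_sign A) = reorder_sign A ?B * conj_sign C"
      using conj_sign_sym_diff[of A ?B] by (simp only: canc)
    finally show "reorder_sign ?B A * (conj_sign ?B * coord b ?B) * (conj_sign A * coord a A)
      = conj_sign C * (reorder_sign A ?B * coord a A * coord b ?B)"
      by (simp only: mult_ac)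
  qed
  also have "\<dots> = coord (cliff_conj (a * b)) C"
    by (simp add: coord_cliff_conj times_clifford.rep_eq sum_distrib_left)
  finally show "coord (cliff_conj (a * b)) C = coord (cliff_conj b * cliff_conj a) C" ..
qed

lemma cliff_conj_add: "cliff_conj (a + b) = cliff_conj a + cliff_conj b"
  by (rule coord_inject[THEN iffD1])
    (simp add: fun_eq_iff coord_cliff_conj plus_clifford.rep_eq distrib_left)

lemma cliff_conj_scaleR: "cliff_conj (r *\<^sub>R a) = r *\<^sub>R cliff_conj a"
  by (rule coord_inject[THEN iffD1])
    (simp add: fun_eq_iff coord_cliff_conj scaleR_clifford.rep_eq)

lemma cliff_conj_1: "cliff_conj 1 = 1"
  by (rule coord_inject[THEN iffD1])
    (simp add: fun_eq_iff coord_cliff_conj one_clifford.rep_eq conj_sign_def reorder_sign_def)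

lemma cliff_conj_e_unit: "cliff_conj (e_unit j) = - e_unit j"
proof -
  have "e_unit j = blade {(j, False)}"
    by (simp add: blade_eq_e e_unit_def)
  then show ?thesis
    by (intro coord_inject[THEN iffD1])
      (simp add: fun_eq_iff coord_cliff_conj uminus_clifford.rep_eq blade.rep_eq conj_sign_def
        reorder_sign_def gen_less_def)
qed

text \<open>
  On \<open>\<xi>\<^sup>\<alpha>[1] c\<close> an operator generated by the \<open>R\<^sub>j\<close> acts as left multiplication of \<open>c\<close> by some \<open>u\<close>,
  which determines the action of the conjugate operator.
\<close>

lemma op_conj_rel_action:
  assumes "op_conj_rel a a'"
  shows "right_linear a \<and> right_linear a' \<and>
    (\<exists>u. (\<forall>c. a (rmult (basic_poly \<alpha>) c) = rmult (basic_poly \<alpha>) (u * c)) \<and>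
         (\<forall>c. a' (rmult (basic_poly \<alpha>) c) = rmult (basic_poly \<alpha>) (cliff_conj u * c)))"
  using assms
proof induction
  case (scalar r)
  show ?case
    by (intro conjI right_linear_intros exI[of _ "r *\<^sub>R 1"])
      (simp_all add: cliff_conj_scaleR cliff_conj_1 rmult_scaleR del: scaleR_conv_of_real)
next
  case (gen j)
  let ?s = "(-1) ^ (\<Sum>i\<in>- {j}. \<alpha> i) :: real"
  show ?case
    by (intro conjI right_linear_intros exI[of _ "?s *\<^sub>R e_unit j"])
      (simp_all add: R_linear R_basic_poly cliff_conj_scaleR cliff_conj_e_unit rmult_scaleR)
next
  case (add a a' b b')
  then obtain u v where
    "\<forall>c. a (rmult (basic_poly \<alpha>) c) = rmult (basic_poly \<alpha>) (u * c)"
    "\<forall>c. a' (rmult (basic_poly \<alpha>) c) = rmult (basic_poly \<alpha>) (cliff_conj u * c)"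
    "\<forall>c. b (rmult (basic_poly \<alpha>) c) = rmult (basic_poly \<alpha>) (v * c)"
    "\<forall>c. b' (rmult (basic_poly \<alpha>) c) = rmult (basic_poly \<alpha>) (cliff_conj v * c)"
    by blast
  with add.IH show ?case
    by (intro conjI right_linear_intros exI[of _ "u + v"])
      (simp_all add: cliff_conj_add distrib_right rmult_distrib)
next
  case (mult a a' b b')
  then obtain u v where
    "\<forall>c. a (rmult (basic_poly \<alpha>) c) = rmult (basic_poly \<alpha>) (u * c)"
    "\<forall>c. a' (rmult (basic_poly \<alpha>) c) = rmult (basic_poly \<alpha>) (cliff_conj u * c)"
    "\<forall>c. b (rmult (basic_poly \<alpha>) c) = rmult (basic_poly \<alpha>) (v * c)"
    "\<forall>c. b' (rmult (basic_poly \<alpha>) c) = rmult (basic_poly \<alpha>) (cliff_conj v * c)"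
    by blast
  with mult.IH show ?case
    by (intro conjI right_linear_intros exI[of _ "u * v"])
      (simp_all add: cliff_conj_mult mult.assoc)
qed

text \<open>Induction over the relation cannot compare two words for one operator. Instead the left
  factor \<open>u\<close> is read off from the action of \<open>a\<close> on
  \<open>\<xi>\<^sup>\<alpha>[1]\<close>, and \<open>cliff_conj u\<close> determines the conjugate
  there.\<close>

lemma op_conj_rel_unique:
  assumes "op_conj_rel a a'" "op_conj_rel a b'"
  shows "a' = b'"
proof
  fix f
  show "a' f = b' f"
  proof (rule right_linear_eqI[of a' b'])
    show "right_linear a'" "right_linear b'"
      using op_conj_rel_action assms by blast+
    fix \<alpha>
    obtain u v where u: "\<forall>c. a (rmult (basic_poly \<alpha>) c) = rmult (basic_poly \<alpha>) (u * c)"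
      "\<forall>c. a' (rmult (basic_poly \<alpha>) c) = rmult (basic_poly \<alpha>) (cliff_conj u * c)"
      and v: "\<forall>c. a (rmult (basic_poly \<alpha>) c) = rmult (basic_poly \<alpha>) (v * c)"
      "\<forall>c. b' (rmult (basic_poly \<alpha>) c) = rmult (basic_poly \<alpha>) (cliff_conj v * c)"
      using op_conj_rel_action[OF assms(1), of \<alpha>] op_conj_rel_action[OF assms(2), of \<alpha>] by blast
    have "rmult (basic_poly \<alpha>) (u * 1) = rmult (basic_poly \<alpha>) (v * 1)"
      using u(1) v(1) by metis
    from arg_cong[OF this, of "\<lambda>f. dcoeff f \<alpha>"] have "u = v"
      by (simp add: dcoeff_rmult dcoeff_basic_poly)
    then show "a' (basic_poly \<alpha>) = b' (basic_poly \<alpha>)"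
      using u(2)[rule_format, of 1] v(2)[rule_format, of 1] by simp
  qed
qed

lemma op_conj_eqI: "op_conj_rel a a' \<Longrightarrow> op_conj a = a'"
  unfolding op_conj_def by (rule the_equality) (auto intro: op_conj_rel_unique)


section \<open>Exponentials\<close>

text \<open>
  The polynomials that are finite sums of eigenvectors of \<open>X\<close> on which \<open>E\<close> acts as \<open>exp X\<close>. This
  turns the exponential series of \<open>X\<close> into finitely many scalar ones.
\<close>

inductive exp_resolved :: "'m::{finite,linorder} dop \<Rightarrow> 'm dop \<Rightarrow> 'm dpoly \<Rightarrow> bool" for X E where
  eigen: "X g = cscale z g \<Longrightarrow> E g = cscale (exp z) g \<Longrightarrow> exp_resolved X E g"
| add: "exp_resolved X E f \<Longrightarrow> exp_resolved X E g \<Longrightarrow> exp_resolved X E (f + g)"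

lemma exp_resolved_sums:
  assumes X: "right_linear X" and E: "right_linear E" and "exp_resolved X E f"
  shows "(\<lambda>n. coord (poly_fun ((1 / fact n) *\<^sub>R (X ^^ n) f) x) A) sums coord (poly_fun (E f) x) A"
  using assms(3)
proof induction
  case (eigen g z)
  have pow: "(X ^^ n) g = cscale (z ^ n) g" for n
    by (induction n) (simp_all add: eigen right_linear_cscale[OF X] mult.commute)
  have "(\<lambda>n. (z ^ n /\<^sub>R fact n) * coord (poly_fun g x) A) sums (exp z * coord (poly_fun g x) A)"
    by (intro sums_mult2 exp_converges)
  then show ?case
    by (simp add: pow eigen cscale_def poly_fun_simps scaleR_clifford.rep_eq coord_mult_cconst
        inverse_eq_divide)
next
  case (add f g)
  from sums_add[OF add.IH] show ?case
    by (simp add: right_linear_add[OF right_linear_funpow[OF X]] right_linear_add[OF E]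
        scaleR_add_right poly_fun_simps plus_clifford.rep_eq)
qed

lemma op_exp_eqI:
  assumes "right_linear X" "right_linear E" "\<And>f. exp_resolved X E f"
  shows "op_exp X = E"
proof
  fix f
  show "op_exp X f = E f"
    unfolding op_exp_def
  proof (rule the_equality)
    show "\<forall>x A. (\<lambda>n. coord (poly_fun ((1 / fact n) *\<^sub>R (X ^^ n) f) x) A) sums coord (poly_fun (E f) x) A"
      using exp_resolved_sums[OF assms] by blast
    fix g
    assume "\<forall>x A. (\<lambda>n. coord (poly_fun ((1 / fact n) *\<^sub>R (X ^^ n) f) x) A) sums coord (poly_fun g x) A"
    then have "coord (poly_fun g x) A = coord (poly_fun (E f) x) A" for x A
      using exp_resolved_sums[OF assms, of f x A] by (meson sums_unique2)
    then show "g = E f"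
      by (intro dpoly_eqI coord_inject[THEN iffD1] ext)
  qed
qed

text \<open>As \<open>B\<close> squares to -1, an eigenvector \<open>g\<close> of \<open>X\<close>
  is the sum of \<open>(g - w B g) / 2\<close> for \<open>w = i\<close> and \<open>w = - i\<close>,
  eigenvectors of \<open>B\<close> with eigenvalue \<open>w\<close>. \<open>B\<close> commutes with
  \<open>X\<close> and \<open>E\<close>, so both remain eigenvectors of these, and the eigenvalues
  add up to \<open>z + \<theta> w\<close>.\<close>

lemma exp_resolved_add_commuting:
  assumes B: "right_linear B" "\<And>f. B (B f) = - f"
    and X: "right_linear X" "\<And>f. B (X f) = X (B f)"
    and E: "right_linear E" "\<And>f. B (E f) = E (B f)"
    and f: "exp_resolved X E f"
  shows "exp_resolved (\<lambda>f. X f + \<theta> *\<^sub>R B f) (\<lambda>f. E (cos \<theta> *\<^sub>R f + sin \<theta> *\<^sub>R B f)) f"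
  using f
proof induction
  case (add f g)
  show ?case by (intro exp_resolved.add add.IH)
next
  case (eigen g z)
  have *: "exp_resolved (\<lambda>f. X f + \<theta> *\<^sub>R B f) (\<lambda>f. E (cos \<theta> *\<^sub>R f + sin \<theta> *\<^sub>R B f)) h"
    if h: "h = (1/2) *\<^sub>R (g - cscale w (B g))" and w: "w * w = - 1"
      and ex: "exp (of_real \<theta> * w) = of_real (cos \<theta>) + of_real (sin \<theta>) * w" for h w
  proof (rule exp_resolved.eigen)
    have Bh: "B h = cscale w h"
      by (simp add: h right_linear_simps[OF B(1)] B(2) cscale_scaleR cscale_distrib w)
    have Xh: "X h = cscale z h" and Eh: "E h = cscale (exp z) h"
      by (simp_all add: h right_linear_simps[OF X(1)] right_linear_simps[OF E(1)] X(2)[symmetric]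
          E(2)[symmetric] eigen right_linear_simps[OF B(1)] cscale_scaleR cscale_distrib mult.commute)
    show "X h + \<theta> *\<^sub>R B h = cscale (z + of_real \<theta> * w) h"
      by (simp add: Xh Bh cscale_distrib cscale_of_real[symmetric])
    show "E (cos \<theta> *\<^sub>R h + sin \<theta> *\<^sub>R B h) = cscale (exp (z + of_real \<theta> * w)) h"
      unfolding exp_add ex
      by (simp add: right_linear_simps[OF E(1)] Bh Eh cscale_of_real[symmetric]
          cscale_distrib[symmetric] algebra_simps)
  qed
  have "exp_resolved (\<lambda>f. X f + \<theta> *\<^sub>R B f) (\<lambda>f. E (cos \<theta> *\<^sub>R f + sin \<theta> *\<^sub>R B f))
    ((1/2) *\<^sub>R (g - cscale \<i> (B g)) + (1/2) *\<^sub>R (g - cscale (- \<i>) (B g)))"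
    by (intro exp_resolved.add *[OF refl])
      (simp_all add: exp_eq_polar cis_conv_exp[symmetric] complex_eq_iff exp_of_real)
  moreover have "(1/2) *\<^sub>R (g - cscale \<i> (B g)) + (1/2) *\<^sub>R (g - cscale (- \<i>) (B g)) = g"
    by (simp add: cscale_distrib scaleR_add_right[symmetric] scaleR_2[symmetric])
  ultimately show ?case by simp
qed


section \<open>Rotations\<close>

definition bivector :: "'m::{finite,linorder} \<Rightarrow> 'm \<Rightarrow> 'm dop" where
  "bivector a b f = R_op b (R_op a f)"

lemma right_linear_bivector: "right_linear (bivector a b)"
  unfolding bivector_def by (intro right_linear_intros)

lemmas [right_linear_intros] = right_linear_compose[OF right_linear_bivector]
lemmas bivector_linear = right_linear_simps[OF right_linear_bivector]

lemma bivector_square: "a \<noteq> b \<Longrightarrow> bivector a b (bivector a b f) = - f"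
  by (simp add: bivector_def R_anticommute[of a b "R_op a f"] R_linear)

lemma R_bivector:
  assumes "a \<noteq> b"
  shows "R_op a (bivector a b f) = - bivector a b (R_op a f)"
    and "R_op b (bivector a b f) = - bivector a b (R_op b f)"
    and "k \<noteq> a \<Longrightarrow> k \<noteq> b \<Longrightarrow> R_op k (bivector a b f) = bivector a b (R_op k f)"
    and "bivector a b (R_op a f) = R_op b f" "bivector a b (R_op b f) = - R_op a f"
proof -
  show 1: "bivector a b (R_op a f) = R_op b f" "bivector a b (R_op b f) = - R_op a f"
    using assms by (simp_all add: bivector_def R_anticommute[of a b] R_linear)
  show "R_op a (bivector a b f) = - bivector a b (R_op a f)"
    unfolding 1 using assms by (simp add: bivector_def R_anticommute[of a b])
  show "R_op b (bivector a b f) = - bivector a b (R_op b f)"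
    unfolding 1 by (simp add: bivector_def)
  show "R_op k (bivector a b f) = bivector a b (R_op k f)" if "k \<noteq> a" "k \<noteq> b"
    using that by (simp add: bivector_def R_anticommute[of k] R_linear)
qed

lemma bivector_commute:
  assumes "a \<noteq> b" "{a, b} \<inter> {c, d} = {}"
  shows "bivector a b (bivector c d f) = bivector c d (bivector a b f)"
  using assms by (simp add: bivector_def[of c d] R_bivector)

text \<open>The closed form of the exponential of \<open>\<theta> / 2\<close> times the bivector,
  whose square is -1 for \<open>a \<noteq> b\<close>. Conjugation applies the half angle on both
  sides and so rotates by \<open>\<theta>\<close>.\<close>

definition turn :: "real \<Rightarrow> 'm::{finite,linorder} \<Rightarrow> 'm \<Rightarrow> 'm dop" where
  "turn \<theta> a b f = cos (\<theta> / 2) *\<^sub>R f + sin (\<theta> / 2) *\<^sub>R bivector a b f"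

definition plane_rotation :: "real \<Rightarrow> 'm \<Rightarrow> 'm \<Rightarrow> 'm \<Rightarrow> 'm \<Rightarrow> real" where
  "plane_rotation \<theta> a b k l =
     (if k = a then (if l = a then cos \<theta> else if l = b then - sin \<theta> else 0)
      else if k = b then (if l = b then cos \<theta> else if l = a then sin \<theta> else 0)
      else if l = k then 1 else 0)"

lemma right_linear_turn: "right_linear (turn \<theta> a b)"
  unfolding turn_def by (intro right_linear_intros)

lemma op_conj_rel_turn:
  assumes "a \<noteq> b"
  shows "op_conj_rel (turn \<theta> a b) (turn (- \<theta>) a b)"
proof -
  let ?c = "\<lambda>f. cos (\<theta> / 2) *\<^sub>R f :: 'a dpoly" and ?s = "\<lambda>f. sin (\<theta> / 2) *\<^sub>R f :: 'a dpoly"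
  have "op_conj_rel (\<lambda>f. ?c f + (?s \<circ> (R_op b \<circ> R_op a)) f)
    (\<lambda>f. ?c f + (((\<lambda>f. - R_op a f) \<circ> (\<lambda>f. - R_op b f)) \<circ> ?s) f)"
    by (intro op_conj_rel.intros)
  moreover have "(\<lambda>f. ?c f + (?s \<circ> (R_op b \<circ> R_op a)) f) = turn \<theta> a b"
    by (simp add: fun_eq_iff turn_def bivector_def)
  moreover have "(\<lambda>f. ?c f + (((\<lambda>f. - R_op a f) \<circ> (\<lambda>f. - R_op b f)) \<circ> ?s) f) = turn (- \<theta>) a b"
    using assms by (simp add: fun_eq_iff turn_def bivector_def R_linear R_anticommute[of a b])
  ultimately show ?thesis by simp
qed

text \<open>What the actions need to know about a torus element \<open>s\<close> with conjugate
  \<open>s'\<close>. All clauses survive composition, so the torus is reached one plane at a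
  time.\<close>

definition rotates :: "'m::{finite,linorder} dop \<Rightarrow> 'm dop \<Rightarrow> ('m \<Rightarrow> 'm \<Rightarrow> real) \<Rightarrow> bool" where
  "rotates s s' M \<longleftrightarrow> right_linear s \<and> right_linear s' \<and> op_conj_rel s s' \<and>
     (\<forall>f. s (s' f) = f) \<and> (\<forall>k f. chi k (s f) = s (chi k f)) \<and>
     (\<forall>k f. s' (R_op k (s f)) = (\<Sum>l\<in>UNIV. M k l *\<^sub>R R_op l f))"

lemma rotates_compose:
  assumes s: "rotates s s' M" and g: "rotates g g' N"
  shows "rotates (s \<circ> g) (g' \<circ> s') (\<lambda>k r. \<Sum>l\<in>UNIV. M k l * N l r)"
proof -
  have g': "right_linear g'" using g by (simp add: rotates_def)
  have "g' (s' (R_op k (s (g f)))) = (\<Sum>r\<in>UNIV. (\<Sum>l\<in>UNIV. M k l * N l r) *\<^sub>R R_op r f)" for k f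
  proof -
    have "g' (s' (R_op k (s (g f)))) = (\<Sum>l\<in>UNIV. M k l *\<^sub>R g' (R_op l (g f)))"
      using s by (simp add: rotates_def right_linear_simps[OF g'])
    also have "\<dots> = (\<Sum>l\<in>UNIV. \<Sum>r\<in>UNIV. (M k l * N l r) *\<^sub>R R_op r f)"
      using g by (simp add: rotates_def scaleR_sum_right)
    also have "\<dots> = (\<Sum>r\<in>UNIV. (\<Sum>l\<in>UNIV. M k l * N l r) *\<^sub>R R_op r f)"
      by (subst sum.swap) (simp add: scaleR_sum_left)
    finally show ?thesis .
  qed
  with s g show ?thesis
    by (simp add: rotates_def right_linear_o op_conj_rel.mult)
qed

text \<open>\<open>R_op a\<close> and \<open>R_op b\<close> anticommute with the bivector, so moving
  them past the turn inverts it and two inverse half turns add up to the full angle. Every other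
  \<open>R_op k\<close> commutes with the bivector, and the turn cancels against its
  inverse.\<close>

lemma rotates_turn:
  assumes ab: "a \<noteq> b"
  shows "rotates (turn \<theta> a b) (turn (- \<theta>) a b) (plane_rotation \<theta> a b)"
  unfolding rotates_def
proof (intro conjI allI right_linear_turn op_conj_rel_turn ab)
  let ?c = "cos (\<theta> / 2)" and ?s = "sin (\<theta> / 2)"
  have half: "cos \<theta> = ?c * ?c - ?s * ?s" "sin \<theta> = 2 * ?s * ?c" "?c * ?c + ?s * ?s = 1"
    using cos_double[of "\<theta> / 2"] sin_double[of "\<theta> / 2"] sin_cos_squared_add3[of "\<theta> / 2"]
    by (simp_all add: power2_eq_square)
  fix f k
  have mult: "turn (- \<theta>) a b (p *\<^sub>R f + q *\<^sub>R bivector a b f)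
    = (?c * p + ?s * q) *\<^sub>R f + (?c * q - ?s * p) *\<^sub>R bivector a b f" for p q f
    using ab by (simp add: turn_def bivector_linear bivector_square algebra_simps)
  have inv: "turn (- \<theta>) a b (turn \<theta> a b f) = f" for f
    unfolding turn_def[of \<theta>] mult using half(3) by (simp add: mult.commute)
  have dbl: "turn (- \<theta>) a b (turn (- \<theta>) a b f) = cos \<theta> *\<^sub>R f - sin \<theta> *\<^sub>R bivector a b f" for f
    using mult[of ?c f "- ?s"] by (simp add: turn_def[of "- \<theta>" _ _ f] half)
  show "turn \<theta> a b (turn (- \<theta>) a b f) = f"
    using ab half(3)
    by (simp add: turn_def bivector_linear bivector_square algebra_simps flip: scaleR_add_left)
  show "chi k (turn \<theta> a b f) = turn \<theta> a b (chi k f)"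
    by (simp add: turn_def chi_linear bivector_def chi_R_commute)
  consider "k = a" | "k = b" | "k \<noteq> a" "k \<noteq> b" by blast
  then show "turn (- \<theta>) a b (R_op k (turn \<theta> a b f)) = (\<Sum>l\<in>UNIV. plane_rotation \<theta> a b k l *\<^sub>R R_op l f)"
  proof cases
    case 1
    have "R_op a (turn \<theta> a b f) = turn (- \<theta>) a b (R_op a f)"
      by (simp add: turn_def R_linear R_bivector(1)[OF ab])
    moreover have "(\<Sum>l\<in>UNIV. plane_rotation \<theta> a b a l *\<^sub>R R_op l f) = cos \<theta> *\<^sub>R R_op a f - sin \<theta> *\<^sub>R R_op b f"
      using ab by (subst sum.mono_neutral_right[of _ "{a, b}"]) (auto simp: plane_rotation_def)
    ultimately show ?thesis using ab by (simp add: 1 dbl R_bivector(4))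
  next
    case 2
    have "R_op b (turn \<theta> a b f) = turn (- \<theta>) a b (R_op b f)"
      by (simp add: turn_def R_linear R_bivector(2)[OF ab])
    moreover have "(\<Sum>l\<in>UNIV. plane_rotation \<theta> a b b l *\<^sub>R R_op l f) = cos \<theta> *\<^sub>R R_op b f + sin \<theta> *\<^sub>R R_op a f"
      using ab by (subst sum.mono_neutral_right[of _ "{a, b}"]) (auto simp: plane_rotation_def)
    ultimately show ?thesis using ab by (simp add: 2 dbl R_bivector(5))
  next
    case 3
    have "R_op k (turn \<theta> a b f) = turn \<theta> a b (R_op k f)"
      using 3 by (simp add: turn_def R_linear R_bivector(3)[OF ab])
    moreover have "(\<Sum>l\<in>UNIV. plane_rotation \<theta> a b k l *\<^sub>R R_op l f) = R_op k f"
      using 3 by (subst sum_singleton_if[where a = k]) (auto simp: plane_rotation_def)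
    ultimately show ?thesis by (simp add: inv)
  qed
qed


section \<open>The maximal torus\<close>

lemma idx_inj:
  assumes "1 \<le> k" "k \<le> CARD('m::{finite,linorder})" "1 \<le> l" "l \<le> CARD('m)"
  shows "(idx k :: 'm) = idx l \<longleftrightarrow> k = l"
  using assms by (auto simp: idx_def nth_eq_iff_index_eq)

definition torus_generator :: "nat \<Rightarrow> 'm::{finite,linorder} dop" where
  "torus_generator j = bivector (idx (2 * j - 1)) (idx (2 * j))"

primrec rotor :: "(nat \<Rightarrow> real) \<Rightarrow> nat \<Rightarrow> 'm::{finite,linorder} dop" where
  "rotor t 0 = id"
| "rotor t (Suc n) = rotor t n \<circ> turn (t (Suc n)) (idx (2 * n + 1)) (idx (2 * n + 2))"

primrec rotor_inv :: "(nat \<Rightarrow> real) \<Rightarrow> nat \<Rightarrow> 'm::{finite,linorder} dop" where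
  "rotor_inv t 0 = id"
| "rotor_inv t (Suc n) = turn (- t (Suc n)) (idx (2 * n + 1)) (idx (2 * n + 2)) \<circ> rotor_inv t n"

lemma right_linear_rotor: "right_linear (rotor t n)"
proof (induction n)
  case (Suc n)
  then show ?case unfolding rotor.simps by (intro right_linear_o right_linear_turn)
qed (simp add: right_linear_id)

lemma torus_generator_commute:
  assumes "1 \<le> i" "i < j" "2 * j \<le> CARD('m::{finite,linorder})"
  shows "torus_generator j (torus_generator i f) = torus_generator i (torus_generator j (f :: 'm dpoly))"
  unfolding torus_generator_def using assms by (intro bivector_commute) (auto simp: idx_inj)

lemma rotor_commute:
  assumes "n < j" "2 * j \<le> CARD('m::{finite,linorder})"
  shows "torus_generator j (rotor t n f) = rotor t n (torus_generator j (f :: 'm dpoly))"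
  using assms
proof (induction n arbitrary: f)
  case (Suc n)
  let ?G = "torus_generator (Suc n) :: 'm dop"
  have r: "rotor t (Suc n) f = rotor t n (cos (t (Suc n) / 2) *\<^sub>R f + sin (t (Suc n) / 2) *\<^sub>R ?G f)"
    for f :: "'m dpoly"
    by (simp add: turn_def torus_generator_def)
  have lin: "right_linear (torus_generator j :: 'm dop)"
    unfolding torus_generator_def by (rule right_linear_bivector)
  have "torus_generator j (?G f) = ?G (torus_generator j f)"
    using Suc.prems by (intro torus_generator_commute) auto
  then show ?case
    using Suc by (simp add: r right_linear_simps[OF lin] del: rotor.simps)
qed simp

text \<open>Each further plane contributes a bivector commuting with the earlier ones, which splits
  the eigenvectors found so far once more.\<close>

lemma exp_resolved_rotor:
  assumes "n \<le> CARD('m::{finite,linorder}) div 2"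
  shows "exp_resolved (\<lambda>f. (1/2) *\<^sub>R (\<Sum>j=1..n. t j *\<^sub>R torus_generator j f)) (rotor t n) (f :: 'm dpoly)"
  using assms
proof (induction n)
  case 0
  show ?case by (rule exp_resolved.eigen[of _ _ 0]) simp_all
next
  case (Suc n)
  let ?B = "torus_generator (Suc n) :: 'm dop"
  let ?X = "\<lambda>f :: 'm dpoly. (1/2) *\<^sub>R (\<Sum>j=1..n. t j *\<^sub>R torus_generator j f)"
  let ?\<theta> = "t (Suc n) / 2"
  have lin: "right_linear (torus_generator j :: 'm dop)" for j
    unfolding torus_generator_def by (rule right_linear_bivector)
  have "exp_resolved (\<lambda>f. ?X f + ?\<theta> *\<^sub>R ?B f) (\<lambda>f. rotor t n (cos ?\<theta> *\<^sub>R f + sin ?\<theta> *\<^sub>R ?B f)) f"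
  proof (rule exp_resolved_add_commuting)
    show "?B (?B f) = - f" for f
      unfolding torus_generator_def using Suc.prems
      by (intro bivector_square) (simp add: idx_inj)
    show "right_linear ?X" by (intro right_linear_intros lin)
    show "?B (?X f) = ?X (?B f)" for f
      unfolding right_linear_scaleR[OF lin] right_linear_sum[OF lin]
      using Suc.prems by (intro arg_cong[of _ _ "(*\<^sub>R) _"] sum.cong refl torus_generator_commute) auto
    show "?B (rotor t n f) = rotor t n (?B f)" for f
      using Suc.prems by (intro rotor_commute) auto
  qed (use Suc in \<open>simp_all add: lin right_linear_rotor\<close>)
  moreover have "(\<lambda>f. ?X f + ?\<theta> *\<^sub>R ?B f) = (\<lambda>f. (1/2) *\<^sub>R (\<Sum>j=1..Suc n. t j *\<^sub>R torus_generator j f))"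
    by (simp add: fun_eq_iff scaleR_add_right)
  moreover have "(\<lambda>f. rotor t n (cos ?\<theta> *\<^sub>R f + sin ?\<theta> *\<^sub>R ?B f)) = rotor t (Suc n)"
    by (simp add: fun_eq_iff turn_def torus_generator_def)
  ultimately show ?case by (simp only:)
qed

lemma torus_element_eq_rotor:
  "torus_element t = (rotor t (CARD('m) div 2) :: 'm::{finite,linorder} dop)"
  unfolding torus_element_def
proof (rule op_exp_eqI)
  let ?n = "CARD('m) div 2"
  show "right_linear (\<lambda>f :: 'm dpoly. (1/2) *\<^sub>R (\<Sum>j=1..?n. t j *\<^sub>R R_op (idx (2 * j)) (R_op (idx (2 * j - 1)) f)))"
    by (intro right_linear_intros)
  show "exp_resolved (\<lambda>f :: 'm dpoly. (1/2) *\<^sub>R (\<Sum>j=1..?n. t j *\<^sub>R R_op (idx (2 * j)) (R_op (idx (2 * j - 1)) f)))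
     (rotor t ?n) f" for f
    using exp_resolved_rotor[OF order.refl, of t f] by (simp add: torus_generator_def bivector_def)
qed (rule right_linear_rotor)

text \<open>Only the columns at \<open>a\<close> and \<open>b\<close> are tracked, because they
  describe what becomes of \<open>chi a\<close> and \<open>chi b\<close>. The first plane produces
  them; later planes avoid \<open>a\<close> and \<open>b\<close> and leave both columns
  unchanged.\<close>

lemma rotates_rotor:
  assumes "1 \<le> n" "n \<le> CARD('m::{finite,linorder}) div 2"
  defines "a \<equiv> idx 1 :: 'm" and "b \<equiv> idx 2 :: 'm"
  shows "\<exists>M. rotates (rotor t n) (rotor_inv t n :: 'm dop) M \<and>
    (\<forall>k. M k a = (if k = a then cos (t 1) else if k = b then sin (t 1) else 0) \<and>
         M k b = (if k = b then cos (t 1) else if k = a then - sin (t 1) else 0))"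
  using assms(1,2)
proof (induction n rule: nat_induct_at_least)
  case base
  then have "a \<noteq> b" by (simp add: a_def b_def idx_inj)
  have r: "rotor t 1 = turn (t 1) a b" "rotor_inv t 1 = turn (- t 1) a b"
    by (simp_all add: a_def b_def numeral_2_eq_2)
  have rot: "rotates (rotor t 1) (rotor_inv t 1) (plane_rotation (t 1) a b)"
    unfolding r using \<open>a \<noteq> b\<close> by (rule rotates_turn)
  show ?case
    using \<open>a \<noteq> b\<close> by (intro exI[of _ "plane_rotation (t 1) a b"] conjI rot) (simp add: plane_rotation_def)
next
  case (Suc n)
  define c d :: 'm where "c = idx (2 * n + 1)" and "d = idx (2 * n + 2)"
  obtain M where M: "rotates (rotor t n) (rotor_inv t n :: 'm dop) M"
    "\<And>k. M k a = (if k = a then cos (t 1) else if k = b then sin (t 1) else 0)"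
    "\<And>k. M k b = (if k = b then cos (t 1) else if k = a then - sin (t 1) else 0)"
    using Suc by auto
  have ne: "c \<noteq> d" "a \<noteq> c" "a \<noteq> d" "b \<noteq> c" "b \<noteq> d"
    using Suc unfolding a_def b_def c_def d_def by (subst idx_inj; simp)+
  let ?N = "plane_rotation (t (Suc n)) c d"
  have N: "?N l a = (if l = a then 1 else 0)" "?N l b = (if l = b then 1 else 0)" for l
    using ne by (auto simp: plane_rotation_def)
  have rot: "rotates (rotor t (Suc n)) (rotor_inv t (Suc n) :: 'm dop) (\<lambda>k r. \<Sum>l\<in>UNIV. M k l * ?N l r)"
    using rotates_compose[OF M(1) rotates_turn[OF ne(1)]] by (simp only: rotor.simps rotor_inv.simps c_def d_def)
  show ?case
    by (intro exI[of _ "\<lambda>k r. \<Sum>l\<in>UNIV. M k l * ?N l r"] conjI rot allI)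
      (simp_all add: N M(2,3) if_distrib[of "(*) _"] cong: if_cong)
qed


section \<open>The action on \<open>f\<^sub>0\<^sup>k[1]\<close>\<close>

definition rotated_chi :: "('m::{finite,linorder} \<Rightarrow> 'm \<Rightarrow> real) \<Rightarrow> 'm \<Rightarrow> 'm dop" where
  "rotated_chi M l f = (\<Sum>k\<in>UNIV. M k l *\<^sub>R chi k f)"

lemma right_linear_rotated_chi: "right_linear (rotated_chi M l)"
  unfolding rotated_chi_def by (intro right_linear_intros)

lemmas [right_linear_intros] = right_linear_compose[OF right_linear_rotated_chi]

lemma rotated_chi_R: "rotated_chi M l (R_op k f) = R_op k (rotated_chi M l f)"
  by (simp add: rotated_chi_def chi_R_commute R_linear)

lemma rotated_chi_commute: "rotated_chi M l (rotated_chi M r f) = rotated_chi M r (rotated_chi M l f)"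
  unfolding rotated_chi_def
  by (simp add: chi_linear scaleR_sum_right, subst sum.swap) (simp add: chi_chi_commute[of _ _ f] mult.commute)

lemma xi_eq_chi: "xi f = (\<Sum>k\<in>UNIV. R_op k (chi k f))"
  by (simp add: xi_def xi_op_eq_chi)

lemma right_linear_xi: "right_linear xi"
  unfolding xi_def by (intro right_linear_intros)

lemma R_op_sandwich: "R_op j (R_op k (R_op j f)) = (if k = j then R_op k f else - R_op k f)"
  by (simp add: R_anticommute[of j k])

lemma sum_with_sandwich:
  fixes g :: "'m::{finite,linorder} \<Rightarrow> 'm dpoly"
  shows "(1/2) *\<^sub>R ((\<Sum>k\<in>UNIV. g k) + (\<Sum>k\<in>UNIV. if k = j then g k else - g k)) = g j"
proof -
  have "(\<Sum>k\<in>UNIV. g k) + (\<Sum>k\<in>UNIV. if k = j then g k else - g k)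
    = (\<Sum>k\<in>UNIV. if k = j then g j + g j else 0)"
    unfolding sum.distrib[symmetric] by (rule sum.cong) auto
  then show ?thesis by (simp flip: scaleR_2)
qed

text \<open>Unfolding gives half of \<open>eta s\<close> plus its conjugate by
  \<open>R_op j\<close>. That conjugation changes the sign of every summand
  \<open>R_op l (rotated_chi M l f)\<close> with \<open>l \<noteq> j\<close>, so the summand at
  \<open>j\<close> alone is left.\<close>

lemma eta_op_rotates:
  assumes "rotates s s' M"
  shows "eta_op s j f = R_op j (rotated_chi M j f)"
proof -
  have s': "right_linear s'" and conj: "op_conj s = s'"
    using assms by (simp_all add: rotates_def op_conj_eqI)
  have eta: "eta s f = (\<Sum>l\<in>UNIV. R_op l (rotated_chi M l f))" for f
  proof -
    have "eta s f = (\<Sum>k\<in>UNIV. s' (R_op k (s (chi k f))))"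
      using assms by (simp add: eta_def conj xi_eq_chi right_linear_sum[OF s'] rotates_def)
    also have "\<dots> = (\<Sum>k\<in>UNIV. \<Sum>l\<in>UNIV. M k l *\<^sub>R R_op l (chi k f))"
      using assms by (simp add: rotates_def)
    also have "\<dots> = (\<Sum>l\<in>UNIV. R_op l (rotated_chi M l f))"
      by (subst sum.swap) (simp add: rotated_chi_def R_linear)
    finally show ?thesis .
  qed
  have "eta_op s j f = (1/2) *\<^sub>R ((\<Sum>l\<in>UNIV. R_op l (rotated_chi M l f))
      + (\<Sum>l\<in>UNIV. if l = j then R_op l (rotated_chi M l f) else - R_op l (rotated_chi M l f)))"
    by (simp add: eta_op_def op_angle_def eta R_linear rotated_chi_R R_op_sandwich)
  then show ?thesis by (simp only: sum_with_sandwich)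
qed

text \<open>\<open>eta_monomial\<close> generalised to arbitrary lists, so that the product can be
  cut at an index.\<close>

definition ordered_product :: "('m \<Rightarrow> 'm dop) \<Rightarrow> 'm list \<Rightarrow> 'm mindex \<Rightarrow> 'm::{finite,linorder} dop" where
  "ordered_product E xs \<alpha> = foldr (\<lambda>j X. (E j ^^ \<alpha> j) \<circ> X) xs id"

lemma ordered_product_simps [simp]:
  "ordered_product E [] \<alpha> f = f"
  "ordered_product E (x # xs) \<alpha> f = (E x ^^ \<alpha> x) (ordered_product E xs \<alpha> f)"
  by (simp_all add: ordered_product_def)

lemma ordered_product_append:
  "ordered_product E (xs @ ys) \<alpha> f = ordered_product E xs \<alpha> (ordered_product E ys \<alpha> f)"
  by (induction xs) simp_all

lemma ordered_product_cong:
  "(\<And>j. j \<in> set xs \<Longrightarrow> \<alpha> j = \<beta> j) \<Longrightarrow> ordered_product E xs \<alpha> f = ordered_product E xs \<beta> f"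
  by (induction xs) simp_all

lemma ordered_product_zero: "ordered_product E xs (\<lambda>_. 0) f = f"
  by (induction xs) simp_all

lemma right_linear_ordered_product:
  "(\<And>j. right_linear (E j)) \<Longrightarrow> right_linear (ordered_product E xs \<alpha>)"
  by (induction xs) (simp_all add: right_linear_def right_linear_add[OF right_linear_funpow]
      right_linear_rmult[OF right_linear_funpow])

text \<open>Used for \<open>eta_op s j\<close> on the way to its own place in the product and for
  \<open>R_op j\<close> passing the whole product. The signs collected reproduce those of
  \<open>xi_op j\<close> and \<open>R_op j\<close> on
  \<open>\<xi>\<^sup>\<alpha>[1]\<close>.\<close>

lemma ordered_product_skew_commute:
  assumes E: "\<And>j. right_linear (E j)" and Z: "right_linear Z"
    and ZE: "\<And>i f. i \<in> set xs \<Longrightarrow> Z (E i f) = \<sigma> i *\<^sub>R E i (Z f)"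
  shows "Z (ordered_product E xs \<alpha> f)
    = (\<Prod>i\<leftarrow>xs. \<sigma> i ^ \<alpha> i) *\<^sub>R ordered_product E xs \<alpha> (Z f)"
  using ZE
proof (induction xs)
  case (Cons x xs)
  have "Z ((E x ^^ n) g) = \<sigma> x ^ n *\<^sub>R (E x ^^ n) (Z g)" for n g
    by (induction n) (simp_all add: Cons.prems right_linear_scaleR[OF E])
  with Cons show ?case
    by (simp add: right_linear_scaleR[OF right_linear_funpow[OF E]])
qed simp

text \<open>
  The substitution \<open>\<xi>\<^sub>j \<mapsto> E\<^sub>j\<close> behind \<open>H\<^sup>0(s)\<close> intertwines the two families of operators, because the
  \<open>E\<^sub>j\<close> satisfy the same relations among themselves and with the \<open>R\<^sub>j\<close> as the \<open>\<xi>\<^sub>j\<close>.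
\<close>

context
  fixes s s' :: "'m::{finite,linorder} dop" and M
  assumes s: "rotates s s' M"
begin

lemma right_linear_eta_op: "right_linear (eta_op s j)"
proof -
  have "eta_op s j = (\<lambda>f. R_op j (rotated_chi M j f))"
    by (simp add: fun_eq_iff eta_op_rotates[OF s])
  then show ?thesis by (simp add: right_linear_compose right_linear_R_op right_linear_rotated_chi)
qed

lemma H0_basic_poly: "H0 s (basic_poly \<alpha>) = ordered_product (eta_op s) (sorted_list_of_set UNIV) \<alpha> one_poly"
  by (simp add: H0_def eta_monomial_def ordered_product_def)

lemma right_linear_H0: "right_linear (H0 s)"
  unfolding H0_def by (rule right_linear_rlinear_ext)

lemma H0_one: "H0 s one_poly = one_poly"
  unfolding one_poly_def H0_basic_poly by (simp add: ordered_product_zero one_poly_def)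

lemma H0_xi_op: "H0 s (xi_op j f) = eta_op s j (H0 s f)"
proof (rule right_linear_eqI[of "\<lambda>f. H0 s (xi_op j f)" "\<lambda>f. eta_op s j (H0 s f)"])
  fix \<alpha> :: "'m mindex"
  obtain ys zs where l: "sorted_list_of_set UNIV = ys @ j # zs" and ys: "set ys = {..<j}" "distinct ys"
    and nin: "j \<notin> set ys" "j \<notin> set zs"
    by (rule sorted_list_of_UNIV_split)
  let ?P = "ordered_product (eta_op s)" and ?\<beta> = "\<alpha>(j := \<alpha> j + 1)"
  have "eta_op s j (eta_op s i f) = (- 1) *\<^sub>R eta_op s i (eta_op s j f)" if "i \<in> set ys" for i f
  proof -
    have "i \<noteq> j" using that nin(1) by auto
    then show ?thesis by (simp add: eta_op_rotates[OF s] rotated_chi_R R_anticommute[of j i] rotated_chi_commute[of M j i])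
  qed
  then have "eta_op s j (?P ys \<alpha> g) = (\<Prod>i\<leftarrow>ys. (- 1) ^ \<alpha> i) *\<^sub>R ?P ys \<alpha> (eta_op s j g)" for g
    by (intro ordered_product_skew_commute right_linear_eta_op)
  moreover have "(\<Prod>i\<leftarrow>ys. (- 1) ^ \<alpha> i) = ((- 1) ^ (\<Sum>i\<in>{..<j}. \<alpha> i) :: real)"
    using ys by (simp add: prod.distinct_set_conv_list[symmetric] power_sum)
  moreover have "?P ys \<alpha> g = ?P ys ?\<beta> g" "?P zs \<alpha> g = ?P zs ?\<beta> g" for g
    using nin by (auto intro!: ordered_product_cong)
  ultimately have "eta_op s j (H0 s (basic_poly \<alpha>)) = (- 1) ^ (\<Sum>i\<in>{..<j}. \<alpha> i) *\<^sub>R H0 s (basic_poly ?\<beta>)"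
    by (simp add: H0_basic_poly l ordered_product_append del: fun_upd_apply) (simp only: fun_upd_same funpow.simps o_apply)
  then show "H0 s (xi_op j (basic_poly \<alpha>)) = eta_op s j (H0 s (basic_poly \<alpha>))"
    by (simp add: xi_basic_poly right_linear_scaleR[OF right_linear_H0])
qed (rule right_linear_compose[OF right_linear_H0 right_linear_xi_op]
    right_linear_compose[OF right_linear_eta_op right_linear_H0])+

lemma H0_R_op: "H0 s (R_op j f) = R_op j (H0 s f)"
proof (rule right_linear_eqI[of "\<lambda>f. H0 s (R_op j f)" "\<lambda>f. R_op j (H0 s f)"])
  fix \<alpha> :: "'m mindex"
  let ?xs = "sorted_list_of_set (UNIV :: 'm set)"
  let ?P = "ordered_product (eta_op s) ?xs \<alpha>"
  \<comment> \<open>\<open>eta_op s j\<close> is \<open>R_op j\<close> composed with an operator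
    that commutes with it, hence the sign 1 for \<open>i = j\<close>.\<close>
  let ?\<sigma> = "\<lambda>i. if i = j then 1 else - 1 :: real"
  have "R_op j (eta_op s i f) = ?\<sigma> i *\<^sub>R eta_op s i (R_op j f)" for i f
    by (simp add: eta_op_rotates[OF s] rotated_chi_R R_anticommute[of j i])
  then have "R_op j (?P one_poly) = (\<Prod>i\<leftarrow>?xs. ?\<sigma> i ^ \<alpha> i) *\<^sub>R ?P (R_op j one_poly)"
    by (intro ordered_product_skew_commute right_linear_eta_op right_linear_R_op) auto
  also have "(\<Prod>i\<leftarrow>?xs. ?\<sigma> i ^ \<alpha> i) = (\<Prod>i\<in>UNIV. ?\<sigma> i ^ \<alpha> i)"
    using prod.distinct_set_conv_list[of ?xs "\<lambda>i. ?\<sigma> i ^ \<alpha> i"] by simp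
  also have "\<dots> = (\<Prod>i\<in>- {j}. (- 1) ^ \<alpha> i)"
    by (rule prod.mono_neutral_cong_right) auto
  also have "\<dots> = (- 1) ^ (\<Sum>i\<in>- {j}. \<alpha> i)"
    by (simp add: power_sum)
  also have "R_op j one_poly = rmult one_poly (e_unit j)"
    by (simp add: one_poly_def R_basic_poly)
  finally show "H0 s (R_op j (basic_poly \<alpha>)) = R_op j (H0 s (basic_poly \<alpha>))"
    by (simp add: R_basic_poly right_linear_simps[OF right_linear_H0] H0_basic_poly
        right_linear_rmult[OF right_linear_ordered_product[OF right_linear_eta_op]])
qed (rule right_linear_compose[OF right_linear_H0 right_linear_R_op]
    right_linear_compose[OF right_linear_R_op right_linear_H0])+

lemma H0_chi: "H0 s (chi j f) = rotated_chi M j (H0 s f)"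
  by (simp add: chi_def H0_R_op H0_xi_op eta_op_rotates[OF s])

end

section \<open>The operator \<open>op_angle xi f1_op\<close> and its weight\<close>

lemma angle_xi_f1: "op_angle xi f1_op f = (1/2) *\<^sub>R (chi (idx 1) f - cscale \<i> (chi (idx 2) f))"
proof -
  have R: "(1/2) *\<^sub>R (xi (R_op j f) + R_op j (xi f)) = chi j f" for j
  proof -
    \<comment> \<open>In the anticommutator of \<open>xi\<close> with \<open>R_op j\<close> the
      summands with \<open>k \<noteq> j\<close> cancel, so \<open>op_angle xi (R_op j)\<close> is
      \<open>chi j\<close>.\<close>
    have "R_op j (R_op k (chi k f)) = (if k = j then R_op k (chi k (R_op j f)) else - R_op k (chi k (R_op j f)))" for k
      by (simp add: chi_R_commute R_anticommute[of j k])
    then have "(1/2) *\<^sub>R (xi (R_op j f) + R_op j (xi f)) = R_op j (chi j (R_op j f))"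
      by (simp add: xi_eq_chi R_linear sum_with_sandwich)
    then show ?thesis by (simp add: chi_R_commute)
  qed
  have "op_angle xi f1_op f = (1/2) *\<^sub>R ((1/2) *\<^sub>R (xi (R_op (idx 1) f) + R_op (idx 1) (xi f))
      - cscale \<i> ((1/2) *\<^sub>R (xi (R_op (idx 2) f) + R_op (idx 2) (xi f))))"
    by (simp add: op_angle_def f1_op_def right_linear_simps[OF right_linear_xi] cscale_distrib
        cscale_scaleR algebra_simps)
  then show ?thesis by (simp only: R)
qed

lemma right_linear_angle_xi_f1: "right_linear (op_angle xi f1_op)"
proof -
  have "op_angle xi f1_op = (\<lambda>f :: 'a dpoly. (1/2) *\<^sub>R (chi (idx 1) f - cscale \<i> (chi (idx 2) f)))"
    by (rule ext) (rule angle_xi_f1)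
  then show ?thesis by (simp only:) (intro right_linear_intros)
qed

text \<open>
  Setting all monomials that contain \<open>\<xi>\<^sub>2\<close> to zero leaves \<open>(R\<^sub>1 \<xi>\<^sub>1 / 2)\<^sup>k[1] = \<xi>\<^sub>1\<^sup>k[1] e\<^sub>1\<^sup>k / 2\<^sup>k\<close>.
\<close>

lemma angle_xi_f1_power_nonzero:
  assumes "CARD('m::{finite,linorder}) \<ge> 2"
  shows "(op_angle xi f1_op ^^ k) one_poly \<noteq> (0 :: 'm dpoly)"
proof
  define a b :: 'm where "a = idx 1" and "b = idx 2"
  have ab: "a \<noteq> b" using assms by (simp add: a_def b_def idx_inj)
  \<comment> \<open>\<open>P\<close> commutes with \<open>xi_op a\<close> and all
    \<open>R_op j\<close> and annihilates the range of \<open>xi_op b\<close>, so it carries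
    \<open>op_angle xi f1_op\<close> to half of \<open>chi a\<close>.\<close>
  define P :: "'m dop" where "P = rlinear_ext (\<lambda>\<alpha>. if \<alpha> b = 0 then basic_poly \<alpha> else 0)"
  have P: "right_linear P" unfolding P_def by (rule right_linear_rlinear_ext)
  have Pb: "P (basic_poly \<alpha>) = (if \<alpha> b = 0 then basic_poly \<alpha> else 0)" for \<alpha>
    by (simp add: P_def)
  have PR: "P (R_op j f) = R_op j (P f)" for j f
    by (rule right_linear_eqI[of "\<lambda>f. P (R_op j f)" "\<lambda>f. R_op j (P f)"];
        (rule right_linear_compose[OF P right_linear_R_op] right_linear_compose[OF right_linear_R_op P])?)
      (simp add: R_basic_poly right_linear_simps[OF P] Pb R_linear)
  have Pxa: "P (xi_op a f) = xi_op a (P f)" for f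
    by (rule right_linear_eqI[of "\<lambda>f. P (xi_op a f)" "\<lambda>f. xi_op a (P f)"];
        (rule right_linear_compose[OF P right_linear_xi_op] right_linear_compose[OF right_linear_xi_op P])?)
      (use ab in \<open>simp add: xi_basic_poly right_linear_simps[OF P] Pb xi_linear\<close>)
  have Pxb: "P (xi_op b f) = 0" for f
    by (rule right_linear_eqI[of "\<lambda>f. P (xi_op b f)" "\<lambda>f. 0"];
        (rule right_linear_compose[OF P right_linear_xi_op])?)
      (simp_all add: xi_basic_poly right_linear_simps[OF P] Pb right_linear_def)
  have PL: "P (op_angle xi f1_op f) = (1/2) *\<^sub>R chi a (P f)" for f
    unfolding angle_xi_f1 a_def[symmetric] b_def[symmetric]
    by (simp add: right_linear_simps[OF P] chi_def PR Pxa Pxb R_linear)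
  let ?\<epsilon> = "\<lambda>k i. if i = a then k else 0 :: nat"
  have "\<exists>d. d \<noteq> 0 \<and> P ((op_angle xi f1_op ^^ k) one_poly) = rmult (basic_poly (?\<epsilon> k)) d"
  proof (induction k)
    case 0
    show ?case by (rule exI[of _ 1]) (simp add: one_poly_def Pb)
  next
    case (Suc k)
    then obtain d where d: "d \<noteq> 0" "P ((op_angle xi f1_op ^^ k) one_poly) = rmult (basic_poly (?\<epsilon> k)) d"
      by blast
    have up: "(?\<epsilon> k)(a := Suc k) = ?\<epsilon> (Suc k)" by auto
    \<comment> \<open>Despite zero divisors this holds, as \<open>e_unit a\<close> is its own
      inverse.\<close>
    have "e_unit a * d \<noteq> 0"
    proof
      assume "e_unit a * d = 0"
      then have "e_unit a * (e_unit a * d) = 0" by simp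
      with d(1) show False by simp
    qed
    moreover have "P ((op_angle xi f1_op ^^ Suc k) one_poly) = rmult (basic_poly (?\<epsilon> (Suc k))) ((1/2) *\<^sub>R (e_unit a * d))"
      by (simp add: PL d(2) chi_linear)
        (simp add: chi_def xi_basic_poly up R_linear R_basic_poly rmult_scaleR del: fun_upd_apply)
    ultimately show ?case by (intro exI[of _ "(1/2) *\<^sub>R (e_unit a * d)"]) simp
  qed
  then obtain d where d: "d \<noteq> 0" "P ((op_angle xi f1_op ^^ k) one_poly) = rmult (basic_poly (?\<epsilon> k)) d"
    by blast
  assume "(op_angle xi f1_op ^^ k) one_poly = (0 :: 'm dpoly)"
  with d(2) have "rmult (basic_poly (?\<epsilon> k)) d = rmult 0 d"
    by (simp add: right_linear_0[OF P])
  then have "dcoeff (basic_poly (?\<epsilon> k)) (?\<epsilon> k) * d = dcoeff 0 (?\<epsilon> k) * d"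
    by (metis dcoeff_rmult)
  moreover have "dcoeff (0 :: 'm dpoly) = (\<lambda>_. 0)"
    by (rule dcoeff_eqI[of "{}"]) simp_all
  ultimately show False using d(1) by (simp add: dcoeff_basic_poly)
qed

lemma torus_action:
  fixes t :: "nat \<Rightarrow> real" and k :: nat
  assumes "CARD('m::{finite,linorder}) \<ge> 2"
  defines "s \<equiv> torus_element t :: 'm dop"
  shows "H0 s (f0_pow k) = cscale (exp (of_nat k * \<i> * of_real (t 1))) (f0_pow k)"
    and "H1 s (f0_pow k) = cscale (exp (of_nat k * \<i> * of_real (t 1))) (f0_pow k)"
proof -
  let ?L = "op_angle xi f1_op :: 'm dop"
  note L = right_linear_angle_xi_f1[where 'a = 'm]
  define a b :: 'm where "a = idx 1" and "b = idx 2"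
  have ab: "a \<noteq> b" using assms by (simp add: a_def b_def idx_inj)
  have "1 \<le> CARD('m) div 2" using assms by simp
  from rotates_rotor[OF this order.refl, of t]
  obtain s' M where s: "rotates s s' M"
    and M: "\<And>k. M k a = (if k = a then cos (t 1) else if k = b then sin (t 1) else 0)"
      "\<And>k. M k b = (if k = b then cos (t 1) else if k = a then - sin (t 1) else 0)"
    unfolding a_def b_def s_def torus_element_eq_rotor by blast
  let ?z = "exp (\<i> * of_real (t 1))"
  have z: "?z = of_real (cos (t 1)) + \<i> * of_real (sin (t 1))"
    by (simp add: exp_Euler cos_of_real sin_of_real)
  have y: "rotated_chi M a f = cos (t 1) *\<^sub>R chi a f + sin (t 1) *\<^sub>R chi b f"
    "rotated_chi M b f = cos (t 1) *\<^sub>R chi b f - sin (t 1) *\<^sub>R chi a f" for f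
    using ab unfolding rotated_chi_def M
    by (subst sum.mono_neutral_right[of _ "{a, b}"]; auto)+
  have HL: "H0 s (?L f) = cscale ?z (?L (H0 s f))" for f
  proof -
    have "H0 s (?L f) = (1/2) *\<^sub>R (rotated_chi M a (H0 s f) - cscale \<i> (rotated_chi M b (H0 s f)))"
      by (simp add: angle_xi_f1 a_def b_def right_linear_simps[OF right_linear_H0[OF s]] H0_chi[OF s])
    \<comment> \<open>The coefficients are \<open>cos + i sin\<close> at \<open>chi a\<close> and
      \<open>sin - i cos = - i (cos + i sin)\<close> at \<open>chi b\<close>.\<close>
    also have "\<dots> = (1/2) *\<^sub>R cscale ?z (chi a (H0 s f) - cscale \<i> (chi b (H0 s f)))"
      unfolding y z by (simp add: cscale_distrib cscale_of_real[symmetric] algebra_simps)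
    finally show ?thesis by (simp add: angle_xi_f1 a_def b_def cscale_scaleR)
  qed
  have "H0 s ((?L ^^ n) one_poly) = cscale (?z ^ n) ((?L ^^ n) one_poly)" for n
    by (induction n) (simp_all add: H0_one[OF s] HL right_linear_cscale[OF L] mult.commute)
  moreover have "?z ^ k = exp (of_nat k * \<i> * of_real (t 1))"
    by (simp add: exp_of_nat_mult mult.assoc)
  ultimately show H0: "H0 s (f0_pow k) = cscale (exp (of_nat k * \<i> * of_real (t 1))) (f0_pow k)"
    by (simp add: f0_pow_def right_linear_scaleR[OF right_linear_H0[OF s]] cscale_scaleR)
  have conj: "op_conj s = s'" and sl: "right_linear s" and ss': "\<And>f. s (s' f) = f"
    and chis: "\<And>k f. chi k (s f) = s (chi k f)" and rel: "op_conj_rel s s'"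
    using s by (simp_all add: rotates_def op_conj_eqI)
  \<comment> \<open>The right factor of \<open>H1\<close>: \<open>s'\<close> sends 1 to a constant
    function with value \<open>u\<close>, which evaluation at the origin recovers.\<close>
  define c where "c = poly_fun (s' one_poly) 0"
  obtain u where "s' (rmult (basic_poly (\<lambda>_. 0)) 1) = rmult (basic_poly (\<lambda>_. 0)) (u * 1)"
    using op_conj_rel_action[OF rel, of "\<lambda>_. 0"] by blast
  then have u: "s' one_poly = rmult one_poly u" by (simp add: one_poly_def)
  then have "c = u" by (simp add: c_def one_poly_def poly_fun_simps basic_fun_one)
  have sL: "s (?L f) = ?L (s f)" for f
    by (simp add: angle_xi_f1 right_linear_simps[OF sl] chis)
  \<comment> \<open>Both additional factors of \<open>H1\<close> are moved through the powers of
    \<open>?L\<close> to the constant 1, where \<open>s (rmult one_poly c)\<close> is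
    \<open>s (s' one_poly)\<close>, that is 1.\<close>
  have "rmult (s ((?L ^^ n) one_poly)) c = (?L ^^ n) one_poly" for n
  proof -
    have "s ((?L ^^ n) f) = (?L ^^ n) (s f)" for f
      by (induction n) (simp_all add: sL)
    then have "rmult (s ((?L ^^ n) one_poly)) c = (?L ^^ n) (s (rmult one_poly c))"
      by (simp add: right_linear_rmult[OF right_linear_funpow[OF L]] right_linear_rmult[OF sl])
    also have "s (rmult one_poly c) = one_poly"
      by (simp add: \<open>c = u\<close> u[symmetric] ss')
    finally show ?thesis .
  qed
  then have "rmult (s (f0_pow k)) c = f0_pow k"
    by (simp add: f0_pow_def right_linear_scaleR[OF sl] rmult_scaleR)
  then show "H1 s (f0_pow k) = cscale (exp (of_nat k * \<i> * of_real (t 1))) (f0_pow k)"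
    by (simp add: H1_def H0 conj c_def[symmetric] right_linear_cscale[OF sl] rmult_cscale)
qed

theorem theorem6:
  fixes k :: nat
  assumes "CARD('m::{finite,linorder}) \<ge> 2"
  shows "(f0_pow k :: 'm dpoly) \<noteq> 0 \<and>
    (\<forall>H \<in> {H0, H1}. \<forall>s \<in> max_torus. \<forall>t :: nat \<Rightarrow> real. s = torus_element t \<longrightarrow>
      H s (f0_pow k :: 'm dpoly) = cscale (exp (of_nat k * \<i> * of_real (t 1))) (f0_pow k))"
proof -
  have "f0_pow k \<noteq> (0 :: 'm dpoly)"
    using angle_xi_f1_power_nonzero[OF assms, of k] by (simp add: f0_pow_def)
  with torus_action[OF assms] show ?thesis by blast
qed

end
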